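(* On a four dimensional Einstein manifold with scalar curvature $R$ and Weyl tensor $W$, for every $k\in\mathbb{N}$, $k\geq 2$, we have $$\begin{aligned} \frac{1}{2}\Delta|\nabla^k W|^{2} =\;& |\nabla^{k+1} W|^{2} + \langle \nabla^k W, \nabla \Delta \nabla^{k-1} W \rangle +\frac{R}{4}|\nabla^k W|^{2}\\ &+ 8\, W_{\alpha\beta\gamma i_0,i_1i_2\cdots i_{k-1}i_k}W_{\alpha\beta\gamma j_0,i_1i_2\cdots i_{k-1}j_k}R_{j_0i_0i_kj_k}\\ &+2\sum_{h=1}^{k-1}W_{\alpha\beta\gamma\delta,i_1i_2\cdots i_{h}\cdots i_{k-1}i_k}W_{\alpha\beta\gamma\delta,i_1i_2\cdots j_{h}\cdots i_{k-1}j_k}R_{j_hi_hi_kj_k}. \end{aligned}$$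
   Context: Manifolds are smooth and without boundary. A Riemannian manifold $(M^n,g)$ is Einstein if $\mathrm{Ric}=\lambda g$ for some constant $\lambda\in\mathbb{R}$; then $R=n\lambda$ is constant. Tensor components are taken in a local orthonormal frame $e_i$, and repeated indices are summed. With $\mathrm{R}(X,Y)Z=\nabla_X\nabla_YZ-\nabla_Y\nabla_XZ-\nabla_{[X,Y]}Z$, the $(0,4)$ Riemann tensor is $R_{ijkl}=g(e_i,\mathrm{R}(e_k,e_l)e_j)$, the Ricci tensor is $R_{ik}=R_{ijkj}$ and the scalar curvature is $R=R_{ii}$. In dimension four the Weyl tensor is $W_{ijkl}=R_{ijkl}-\frac12(R_{ik}g_{jl}-R_{il}g_{jk}+R_{jl}g_{ik}-R_{jk}g_{il})+\frac{R}{6}(g_{ik}g_{jl}-g_{il}g_{jk})$. Indices after a comma denote covariant derivatives, taken in the order written: $T_{\ldots,i_1\cdots i_k}=\nabla_{i_k}\cdots\nabla_{i_1}T_{\ldots}$. The Laplacian is $\Delta T_{\ldots}=T_{\ldots,pp}$. Inner products and norms are full contractions: $|\nabla^kW|^2=W_{\alpha\beta\gamma\delta,i_1\cdots i_k}W_{\alpha\beta\gamma\delta,i_1\cdots i_k}$ and $\langle\nabla^kW,\nabla\Delta\nabla^{k-1}W\rangle=W_{\alpha\beta\gamma\delta,i_1\cdots i_k}W_{\alpha\beta\gamma\delta,i_1\cdots i_{k-1}tti_k}$. In the $h$-th summand the index string of the second factor is obtained from $i_1\cdots i_{k-1}i_k$ by replacing $i_h$ with $j_h$ and $i_k$ with $j_k$.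 *)

theory Defs
  imports "HOL-Analysis.Analysis"
begin

section \<open>Smooth manifolds\<close>

fun Ck_on :: "nat \<Rightarrow> (real^'n) set \<Rightarrow> (real^'n \<Rightarrow> 'b::real_normed_vector) \<Rightarrow> bool" where
  "Ck_on 0 S f \<longleftrightarrow> continuous_on S f"
| "Ck_on (Suc k) S f \<longleftrightarrow>
     f differentiable_on S \<and> (\<forall>v. Ck_on k S (\<lambda>x. frechet_derivative f (at x) v))"

text \<open>Only meant for open \<open>S\<close>.\<close>

definition smooth_on :: "(real^'n) set \<Rightarrow> (real^'n \<Rightarrow> 'b::real_normed_vector) \<Rightarrow> bool" where
  "smooth_on S f \<longleftrightarrow> (\<forall>k. Ck_on k S f)"

text \<open>A chart is a pair of a domain and a coordinate map; the coordinate map is only relevant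
  on the domain.  The manifold is the whole type \<open>'a\<close>.\<close>

type_synonym ('a, 'n) chart = "'a set \<times> ('a \<Rightarrow> real^'n)"

abbreviation chart_inv :: "('a, 'n) chart \<Rightarrow> real^'n \<Rightarrow> 'a" where
  "chart_inv c \<equiv> inv_into (fst c) (snd c)"

definition smooth_atlas ::
  "('a::{t2_space, second_countable_topology}, 'n::finite) chart set \<Rightarrow> bool" where
  "smooth_atlas A \<longleftrightarrow>
     (\<Union>c\<in>A. fst c) = UNIV \<and>
     (\<forall>c\<in>A. open (fst c) \<and> open (snd c ` fst c) \<and>
        homeomorphism (fst c) (snd c ` fst c) (snd c) (chart_inv c)) \<and>
     (\<forall>c\<in>A. \<forall>d\<in>A. smooth_on (snd c ` (fst c \<inter> fst d)) (snd d \<circ> chart_inv c))"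

definition smooth_fun_on ::
  "('a::topological_space, 'n::finite) chart set \<Rightarrow> 'a set \<Rightarrow> ('a \<Rightarrow> real) \<Rightarrow> bool" where
  "smooth_fun_on A U f \<longleftrightarrow> (\<forall>c\<in>A. smooth_on (snd c ` (fst c \<inter> U)) (f \<circ> chart_inv c))"

definition smooth_fun_at ::
  "('a::topological_space, 'n::finite) chart set \<Rightarrow> 'a \<Rightarrow> ('a \<Rightarrow> real) \<Rightarrow> bool" where
  "smooth_fun_at A p f \<longleftrightarrow> (\<exists>U. open U \<and> p \<in> U \<and> smooth_fun_on A U f)"

text \<open>A tangent vector at \<open>p\<close> is a directional derivative operator acting on the functions that
  are smooth near \<open>p\<close>.  Setting it to zero on all other functions makes equality of tangent
  vectors coincide with equality of HOL functions; this is also the reason for the case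
  distinction in the Lie bracket below.\<close>

type_synonym 'a tvec = "('a \<Rightarrow> real) \<Rightarrow> real"
type_synonym 'a vfield = "'a \<Rightarrow> 'a tvec"

definition tangent_space ::
  "('a::topological_space, 'n::finite) chart set \<Rightarrow> 'a \<Rightarrow> 'a tvec set" where
  "tangent_space A p = {v. \<exists>c\<in>A. p \<in> fst c \<and> (\<exists>u. v = (\<lambda>f.
     if smooth_fun_at A p f then frechet_derivative (f \<circ> chart_inv c) (at (snd c p)) u else 0))}"

text \<open>Smooth vector fields on an open set \<open>U\<close>; the values outside \<open>U\<close> are irrelevant.\<close>

definition vector_field_on ::
  "('a::topological_space, 'n::finite) chart set \<Rightarrow> 'a set \<Rightarrow> 'a vfield \<Rightarrow> bool" where
  "vector_field_on A U X \<longleftrightarrow>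
     (\<forall>p\<in>U. X p \<in> tangent_space A p) \<and>
     (\<forall>V f. open V \<and> V \<subseteq> U \<and> smooth_fun_on A V f \<longrightarrow> smooth_fun_on A V (\<lambda>p. X p f))"

definition vf_add :: "'a vfield \<Rightarrow> 'a vfield \<Rightarrow> 'a vfield" where
  "vf_add X Y = (\<lambda>p f. X p f + Y p f)"

definition vf_diff :: "'a vfield \<Rightarrow> 'a vfield \<Rightarrow> 'a vfield" where
  "vf_diff X Y = (\<lambda>p f. X p f - Y p f)"

definition vf_scale :: "('a \<Rightarrow> real) \<Rightarrow> 'a vfield \<Rightarrow> 'a vfield" where
  "vf_scale h X = (\<lambda>p f. h p * X p f)"

definition lie_bracket ::
  "('a::topological_space, 'n::finite) chart set \<Rightarrow> 'a vfield \<Rightarrow> 'a vfield \<Rightarrow> 'a vfield" where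
  "lie_bracket A X Y = (\<lambda>p f.
     if smooth_fun_at A p f then X p (\<lambda>q. Y q f) - Y p (\<lambda>q. X q f) else 0)"


section \<open>Riemannian metrics and curvature\<close>

type_synonym 'a metric = "'a \<Rightarrow> 'a tvec \<Rightarrow> 'a tvec \<Rightarrow> real"

definition riemannian_metric ::
  "('a::topological_space, 'n::finite) chart set \<Rightarrow> 'a metric \<Rightarrow> bool" where
  "riemannian_metric A g \<longleftrightarrow>
     (\<forall>p. \<forall>u\<in>tangent_space A p. \<forall>v\<in>tangent_space A p. \<forall>w\<in>tangent_space A p. \<forall>a b.
        g p (\<lambda>f. a * u f + b * v f) w = a * g p u w + b * g p v w) \<and>
     (\<forall>p. \<forall>u\<in>tangent_space A p. \<forall>v\<in>tangent_space A p. g p u v = g p v u) \<and>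
     (\<forall>p. \<forall>v\<in>tangent_space A p. v \<noteq> (\<lambda>f. 0) \<longrightarrow> g p v v > 0) \<and>
     (\<forall>U X Y. open U \<and> vector_field_on A U X \<and> vector_field_on A U Y \<longrightarrow>
        smooth_fun_on A U (\<lambda>p. g p (X p) (Y p)))"

text \<open>\<open>D X Y\<close> is \<open>\<nabla>\<^sub>X Y\<close>.  The connection acts on vector fields defined on arbitrary
  open subsets, such as local frames.\<close>

type_synonym 'a connection = "'a vfield \<Rightarrow> 'a vfield \<Rightarrow> 'a vfield"

definition levi_civita_connection ::
  "('a::topological_space, 'n::finite) chart set \<Rightarrow> 'a metric \<Rightarrow> 'a connection \<Rightarrow> bool" where
  "levi_civita_connection A g D \<longleftrightarrow> (\<forall>U X Y Z h.
     open U \<and> vector_field_on A U X \<and> vector_field_on A U Y \<and> vector_field_on A U Z \<and>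
     smooth_fun_on A U h \<longrightarrow>
       vector_field_on A U (D X Y) \<and>
       (\<forall>p\<in>U.
          D (vf_add X Y) Z p = vf_add (D X Z) (D Y Z) p \<and>
          D (vf_scale h X) Y p = vf_scale h (D X Y) p \<and>
          D X (vf_add Y Z) p = vf_add (D X Y) (D X Z) p \<and>
          D X (vf_scale h Y) p = vf_add (vf_scale (\<lambda>q. X q h) Y) (vf_scale h (D X Y)) p \<and>
          X p (\<lambda>q. g q (Y q) (Z q)) = g p (D X Y p) (Z p) + g p (Y p) (D X Z p) \<and>
          vf_diff (D X Y) (D Y X) p = lie_bracket A X Y p))"

definition curvature ::
  "('a::topological_space, 'n::finite) chart set \<Rightarrow> 'a connection \<Rightarrow>
   'a vfield \<Rightarrow> 'a vfield \<Rightarrow> 'a vfield \<Rightarrow> 'a vfield" where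
  "curvature A D X Y Z =
     vf_diff (vf_diff (D X (D Y Z)) (D Y (D X Z))) (D (lie_bracket A X Y) Z)"

definition orthonormal_frame_on ::
  "('a::topological_space, 'n::finite) chart set \<Rightarrow> 'a metric \<Rightarrow> 'a set \<Rightarrow> ('n \<Rightarrow> 'a vfield) \<Rightarrow> bool"
  where
  "orthonormal_frame_on A g U e \<longleftrightarrow> open U \<and> (\<forall>i. vector_field_on A U (e i)) \<and>
     (\<forall>p\<in>U. \<forall>i j. g p (e i p) (e j p) = (if i = j then 1 else 0))"

text \<open>A covariant tensor of rank \<open>r\<close> is a function of lists of \<open>r\<close> vector fields; its components
  \<open>T\<^sub>i\<^sub>j\<^sub>\<dots>\<close> in a frame are the values on lists of frame fields.  Traces are taken with respect
  to an orthonormal frame \<open>e\<close>, and do not depend on it.\<close>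

type_synonym 'a tensor = "'a vfield list \<Rightarrow> 'a \<Rightarrow> real"

definition component :: "('n \<Rightarrow> 'a vfield) \<Rightarrow> 'a tensor \<Rightarrow> 'n list \<Rightarrow> 'a \<Rightarrow> real" where
  "component e T I = T (map e I)"

definition metric_tensor :: "'a metric \<Rightarrow> 'a tensor" where
  "metric_tensor g Xs = (\<lambda>p. g p ((Xs ! 0) p) ((Xs ! 1) p))"

definition riemann ::
  "('a::topological_space, 'n::finite) chart set \<Rightarrow> 'a metric \<Rightarrow> 'a connection \<Rightarrow> 'a tensor" where
  "riemann A g D Xs = (\<lambda>p. g p ((Xs ! 0) p) (curvature A D (Xs ! 2) (Xs ! 3) (Xs ! 1) p))"

definition ricci ::
  "('a::topological_space, 'n::finite) chart set \<Rightarrow> 'a metric \<Rightarrow> 'a connection \<Rightarrow>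
   ('n \<Rightarrow> 'a vfield) \<Rightarrow> 'a tensor" where
  "ricci A g D e Xs = (\<lambda>p. \<Sum>j\<in>UNIV. riemann A g D [Xs ! 0, e j, Xs ! 1, e j] p)"

definition scalar_curvature ::
  "('a::topological_space, 'n::finite) chart set \<Rightarrow> 'a metric \<Rightarrow> 'a connection \<Rightarrow>
   ('n \<Rightarrow> 'a vfield) \<Rightarrow> 'a \<Rightarrow> real" where
  "scalar_curvature A g D e = (\<lambda>p. \<Sum>i\<in>UNIV. ricci A g D e [e i, e i] p)"

definition einstein ::
  "('a::topological_space, 'n::finite) chart set \<Rightarrow> 'a metric \<Rightarrow> 'a connection \<Rightarrow> bool" where
  "einstein A g D \<longleftrightarrow> (\<exists>c::real. \<forall>U e X Y.
     orthonormal_frame_on A g U e \<and> vector_field_on A U X \<and> vector_field_on A U Y \<longrightarrow>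
     (\<forall>p\<in>U. ricci A g D e [X, Y] p = c * metric_tensor g [X, Y] p))"

text \<open>The Weyl tensor in dimension four.\<close>

definition weyl ::
  "('a::topological_space, 4) chart set \<Rightarrow> 'a metric \<Rightarrow> 'a connection \<Rightarrow>
   (4 \<Rightarrow> 'a vfield) \<Rightarrow> 'a tensor" where
  "weyl A g D e Xs = (\<lambda>p.
     let G = (\<lambda>a b. metric_tensor g [Xs ! a, Xs ! b] p);
         Rc = (\<lambda>a b. ricci A g D e [Xs ! a, Xs ! b] p)
     in riemann A g D Xs p
        - 1/2 * (Rc 0 2 * G 1 3 - Rc 0 3 * G 1 2 + Rc 1 3 * G 0 2 - Rc 1 2 * G 0 3)
        + scalar_curvature A g D e p / 6 * (G 0 2 * G 1 3 - G 0 3 * G 1 2))"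


section \<open>Covariant derivatives of tensors\<close>

text \<open>The direction of differentiation is the last argument:
  \<open>T\<^sub>i\<^sub>\<dots>\<^sub>,\<^sub>j\<close> is the value of \<open>cov_deriv D T\<close> on \<open>[e i, \<dots>, e j]\<close>.\<close>

definition cov_deriv :: "'a connection \<Rightarrow> 'a tensor \<Rightarrow> 'a tensor" where
  "cov_deriv D T Xs = (\<lambda>p.
     let Ys = butlast Xs; X = last Xs
     in X p (T Ys) - (\<Sum>m<length Ys. T (Ys[m := D X (Ys ! m)]) p))"

definition tensor_laplacian ::
  "'a connection \<Rightarrow> ('n::finite \<Rightarrow> 'a vfield) \<Rightarrow> 'a tensor \<Rightarrow> 'a tensor" where
  "tensor_laplacian D e T Xs = (\<lambda>p. \<Sum>t\<in>UNIV. cov_deriv D (cov_deriv D T) (Xs @ [e t, e t]) p)"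

text \<open>The Laplacian of a function, viewed as a tensor of rank zero.\<close>

definition laplacian ::
  "'a connection \<Rightarrow> ('n::finite \<Rightarrow> 'a vfield) \<Rightarrow> ('a \<Rightarrow> real) \<Rightarrow> 'a \<Rightarrow> real" where
  "laplacian D e f = tensor_laplacian D e (\<lambda>_. f) []"

definition tensor_inner ::
  "('n::finite \<Rightarrow> 'a vfield) \<Rightarrow> nat \<Rightarrow> 'a tensor \<Rightarrow> 'a tensor \<Rightarrow> 'a \<Rightarrow> real" where
  "tensor_inner e r S T = (\<lambda>p. \<Sum>I\<in>{I. length I = r}. component e S I p * component e T I p)"

definition tensor_norm_sq ::
  "('n::finite \<Rightarrow> 'a vfield) \<Rightarrow> nat \<Rightarrow> 'a tensor \<Rightarrow> 'a \<Rightarrow> real" where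
  "tensor_norm_sq e r T = tensor_inner e r T T"

end

theory Submission
  imports Defs
begin

text \<open>
  Write \<open>S = \<nabla>T\<close> for a tensor \<open>T\<close>. Metric compatibility gives
  \<open>\<Delta>|S|\<^sup>2 / 2 = |\<nabla>S|\<^sup>2 + \<langle>S, \<Delta>S\<rangle>\<close>, and \<open>\<Delta>\<nabla>T\<close> is turned into \<open>\<nabla>\<Delta>T\<close> by two applications of
  the Ricci identity: to \<open>T\<close>, then differentiated, and to \<open>\<nabla>T\<close>. The derivative falling on the
  curvature yields a divergence of the Riemann tensor, which vanishes on an Einstein manifold by the
  second Bianchi identity. What remains is one curvature term, counted twice, for every index of
  \<open>T\<close>, and a Ricci term from the derivative index, equal to \<open>R / 4\<close> times \<open>\<nabla>T\<close>. For
  \<open>T = \<nabla>\<^bsup>k-1\<^esup>W\<close> the four Weyl indices contribute equally, since covariant derivatives inherit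
  the symmetries of \<open>W\<close>; hence the coefficient 8.
\<close>

section \<open>Smooth functions and tangent vectors\<close>

text \<open>No bump functions and no normal frame occur. Fields are total functions of which only
  the values on the domain U of the frame are meaningful, so two habits of tensor calculus need a
  substitute: that an expression depends on a field only through its value at p, and that the frame
  may be treated as constant when a trace is differentiated. For the first, \<open>linear_at\<close>
  records linearity over functions smooth on U; the frame fields live on the same U and the
  coefficients g(X, e i) are smooth there, so such an expression can be expanded in the frame
  directly. For the second, the connection forms of an orthonormal frame are skew, and the
  corrections by \<open>D X (e t)\<close> cancel in every contraction. Commuting the Laplacian with
  the derivative then works for any tensor on an Einstein manifold of any dimension; dimension four
  enters only through the shape of the Weyl tensor and through R = 4 c. The definition of W contains
  traces over the frame. Under Ric = c g it becomes the Riemann tensor minus a multiple of the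
  constant curvature tensor, and in this form it is shown to be a tensor with the expected
  symmetries.\<close>

lemma frechet_derivative_cong_open:
  assumes "open S" "x \<in> S" "\<And>y. y \<in> S \<Longrightarrow> f y = g y" "f differentiable (at x)"
  shows "g differentiable (at x)" "frechet_derivative g (at x) = frechet_derivative f (at x)"
proof -
  have "(f has_derivative frechet_derivative f (at x)) (at x)"
    using assms(4) frechet_derivative_works by blast
  then have g: "(g has_derivative frechet_derivative f (at x)) (at x)"
    using has_derivative_transform_within_open assms by metis
  show "g differentiable (at x)" using g differentiable_def by blast
  show "frechet_derivative g (at x) = frechet_derivative f (at x)"
    using frechet_derivative_at[OF g] by simp
qed

lemma Ck_on_cong_open:
  assumes "open S" "\<And>x. x \<in> S \<Longrightarrow> f x = g x" "Ck_on k S f"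
  shows "Ck_on k S g"
  using assms(2,3)
proof (induction k arbitrary: f g)
  case 0
  then show ?case by (metis Ck_on.simps(1) continuous_on_cong)
next
  case (Suc k)
  have d: "f differentiable (at x)" if "x \<in> S" for x
    using Suc.prems(2) that assms(1) by (simp add: differentiable_on_eq_differentiable_at)
  note c = frechet_derivative_cong_open[OF assms(1) _ Suc.prems(1) d]
  have "g differentiable_on S"
    using c(1) assms(1) by (simp add: differentiable_on_eq_differentiable_at)
  moreover have "Ck_on k S (\<lambda>x. frechet_derivative g (at x) v)" for v
    by (rule Suc.IH[of "\<lambda>x. frechet_derivative f (at x) v"]) (use c(2) Suc.prems(2) in auto)
  ultimately show ?case by simp
qed

lemma Ck_on_SucD: "Ck_on (Suc k) S f \<Longrightarrow> Ck_on k S f"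
proof (induction k arbitrary: f)
  case 0
  then show ?case using differentiable_imp_continuous_on by auto
next
  case (Suc k)
  then show ?case by (meson Ck_on.simps(2))
qed

lemma Ck_on_subset:
  assumes "T \<subseteq> S" "Ck_on k S f"
  shows "Ck_on k T f"
  using assms(2)
proof (induction k arbitrary: f)
  case 0
  then show ?case using assms(1) continuous_on_subset by auto
next
  case (Suc k)
  then show ?case using assms(1) differentiable_on_subset by auto
qed

lemma Ck_on_const: "Ck_on k S (\<lambda>x. c)"
  by (induction k arbitrary: c) auto

lemma frechet_derivative_add:
  assumes "f differentiable (at x)" "g differentiable (at x)"
  shows "frechet_derivative (\<lambda>x. f x + g x) (at x) v
    = frechet_derivative f (at x) v + frechet_derivative g (at x) v"
proof -
  have "((\<lambda>x. f x + g x) has_derivative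
      (\<lambda>h. frechet_derivative f (at x) h + frechet_derivative g (at x) h)) (at x)"
    using assms frechet_derivative_works by (blast intro: has_derivative_add)
  from frechet_derivative_at[OF this] show ?thesis by metis
qed

lemma Ck_on_add:
  assumes "open S" "Ck_on k S f" "Ck_on k S g"
  shows "Ck_on k S (\<lambda>x. f x + g x)"
  using assms(2,3)
proof (induction k arbitrary: f g)
  case 0
  then show ?case by (simp add: continuous_on_add)
next
  case (Suc k)
  have d: "f differentiable (at x)" "g differentiable (at x)" if "x \<in> S" for x
    using Suc.prems that assms(1) by (simp_all add: differentiable_on_eq_differentiable_at)
  have "Ck_on k S (\<lambda>x. frechet_derivative (\<lambda>x. f x + g x) (at x) v)" for v
    by (rule Ck_on_cong_open[OF assms(1) _ Suc.IH[of "\<lambda>x. frechet_derivative f (at x) v"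
          "\<lambda>x. frechet_derivative g (at x) v"]])
      (use d Suc.prems in \<open>auto simp: frechet_derivative_add\<close>)
  moreover have "(\<lambda>x. f x + g x) differentiable_on S"
    using Suc.prems by (simp add: differentiable_on_add)
  ultimately show ?case by simp
qed

lemma frechet_derivative_mult:
  fixes f g :: "'b::real_normed_vector \<Rightarrow> real"
  assumes "f differentiable (at x)" "g differentiable (at x)"
  shows "frechet_derivative (\<lambda>x. f x * g x) (at x) v
    = f x * frechet_derivative g (at x) v + frechet_derivative f (at x) v * g x"
proof -
  have "((\<lambda>x. f x * g x) has_derivative
      (\<lambda>h. f x * frechet_derivative g (at x) h + frechet_derivative f (at x) h * g x)) (at x)"
    using assms frechet_derivative_works by (blast intro: has_derivative_mult)
  from frechet_derivative_at[OF this] show ?thesis by metis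
qed

lemma Ck_on_mult:
  fixes f g :: "real^'n \<Rightarrow> real"
  assumes "open S" "Ck_on k S f" "Ck_on k S g"
  shows "Ck_on k S (\<lambda>x. f x * g x)"
  using assms(2,3)
proof (induction k arbitrary: f g)
  case 0
  then show ?case by (simp add: continuous_on_mult)
next
  case (Suc k)
  have d: "f differentiable (at x)" "g differentiable (at x)" if "x \<in> S" for x
    using Suc.prems that assms(1) by (simp_all add: differentiable_on_eq_differentiable_at)
  have "Ck_on k S (\<lambda>x. f x * frechet_derivative g (at x) v + frechet_derivative f (at x) v * g x)" for v
    using Suc.prems Suc.IH Ck_on_SucD[OF Suc.prems(1)] Ck_on_SucD[OF Suc.prems(2)]
    by (intro Ck_on_add assms(1)) auto
  then have "Ck_on k S (\<lambda>x. frechet_derivative (\<lambda>x. f x * g x) (at x) v)" for v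
    by (rule Ck_on_cong_open[OF assms(1), rotated]) (simp add: frechet_derivative_mult d)
  moreover have "(\<lambda>x. f x * g x) differentiable_on S"
    using d assms(1) by (simp add: differentiable_on_eq_differentiable_at)
  ultimately show ?case by simp
qed

lemma smooth_on_differentiable:
  assumes "smooth_on S f" "open S" "x \<in> S"
  shows "f differentiable (at x)"
proof -
  have "Ck_on (Suc 0) S f" using assms(1) unfolding smooth_on_def by blast
  then show ?thesis using assms(2,3) by (simp add: differentiable_on_eq_differentiable_at)
qed

section \<open>Smooth functions on a manifold and their germs\<close>

locale manifold =
  fixes A :: "('a::{t2_space, second_countable_topology}, 'n::finite) chart set"
  assumes atlas: "smooth_atlas A"
begin

lemma chart_at: "\<exists>c\<in>A. p \<in> fst c"
  using atlas unfolding smooth_atlas_def by blast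

lemma open_chart_image:
  assumes "c \<in> A" "open V"
  shows "open (snd c ` (fst c \<inter> V))"
proof -
  have h: "homeomorphism (fst c) (snd c ` fst c) (snd c) (chart_inv c)"
    and o: "open (snd c ` fst c)"
    using atlas assms(1) unfolding smooth_atlas_def by blast+
  have "openin (top_of_set (fst c)) (fst c \<inter> V)"
    using assms(2) by (simp add: openin_open_Int)
  then have "openin (top_of_set (snd c ` fst c)) (snd c ` (fst c \<inter> V))"
    using h homeomorphism_imp_open_map by blast
  then show ?thesis using o openin_open_trans by blast
qed

lemma chart_inv_chart:
  assumes "c \<in> A" "p \<in> fst c"
  shows "chart_inv c (snd c p) = p"
  using atlas assms unfolding smooth_atlas_def homeomorphism_def by blast

lemma smooth_fun_on_cong:
  assumes "open V" "\<And>q. q \<in> V \<Longrightarrow> f q = h q" "smooth_fun_on A V f"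
  shows "smooth_fun_on A V h"
  unfolding smooth_fun_on_def smooth_on_def
proof (intro ballI allI)
  fix c k assume c: "c \<in> A"
  show "Ck_on k (snd c ` (fst c \<inter> V)) (h \<circ> chart_inv c)"
    by (rule Ck_on_cong_open[of _ "f \<circ> chart_inv c"])
      (use c assms open_chart_image chart_inv_chart in
        \<open>auto simp: smooth_fun_on_def smooth_on_def\<close>)
qed

lemma smooth_fun_on_subset:
  assumes "V' \<subseteq> V" "smooth_fun_on A V f"
  shows "smooth_fun_on A V' f"
  unfolding smooth_fun_on_def smooth_on_def
proof (intro ballI allI)
  fix c k assume c: "c \<in> A"
  show "Ck_on k (snd c ` (fst c \<inter> V')) (f \<circ> chart_inv c)"
    by (rule Ck_on_subset[of _ "snd c ` (fst c \<inter> V)"])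
      (use c assms in \<open>auto simp: smooth_fun_on_def smooth_on_def\<close>)
qed

lemma smooth_fun_on_const: "smooth_fun_on A V (\<lambda>q. a)"
  unfolding smooth_fun_on_def smooth_on_def by (simp add: comp_def Ck_on_const)

lemma smooth_fun_on_add:
  assumes "open V" "smooth_fun_on A V f" "smooth_fun_on A V h"
  shows "smooth_fun_on A V (\<lambda>q. f q + h q)"
  unfolding smooth_fun_on_def smooth_on_def comp_def
  by (intro ballI allI Ck_on_add open_chart_image assms(1))
    (use assms(2,3) in \<open>auto simp: smooth_fun_on_def smooth_on_def comp_def\<close>)

lemma smooth_fun_on_mult:
  assumes "open V" "smooth_fun_on A V f" "smooth_fun_on A V h"
  shows "smooth_fun_on A V (\<lambda>q. f q * h q)"
  unfolding smooth_fun_on_def smooth_on_def comp_def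
  by (intro ballI allI Ck_on_mult open_chart_image assms(1))
    (use assms(2,3) in \<open>auto simp: smooth_fun_on_def smooth_on_def comp_def\<close>)

lemma smooth_fun_on_diff:
  assumes "open V" "smooth_fun_on A V f" "smooth_fun_on A V h"
  shows "smooth_fun_on A V (\<lambda>q. f q - h q)"
  using smooth_fun_on_add[OF assms(1,2) smooth_fun_on_mult[OF assms(1) smooth_fun_on_const[of _ "-1"] assms(3)]]
  by simp

lemma smooth_fun_on_sum:
  assumes "open V" "\<And>i. i \<in> I \<Longrightarrow> smooth_fun_on A V (f i)"
  shows "smooth_fun_on A V (\<lambda>q. \<Sum>i\<in>I. f i q)"
  using assms(2)
  by (induction I rule: infinite_finite_induct)
    (simp_all add: smooth_fun_on_const smooth_fun_on_add[OF assms(1)])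

lemma smooth_fun_atI: "open V \<Longrightarrow> p \<in> V \<Longrightarrow> smooth_fun_on A V f \<Longrightarrow> smooth_fun_at A p f"
  unfolding smooth_fun_at_def by blast

lemma smooth_fun_at_binop:
  assumes "\<And>V f h. open V \<Longrightarrow> smooth_fun_on A V f \<Longrightarrow> smooth_fun_on A V h
      \<Longrightarrow> smooth_fun_on A V (\<lambda>q. b (f q) (h q))"
    and "smooth_fun_at A p f" "smooth_fun_at A p h"
  shows "smooth_fun_at A p (\<lambda>q. b (f q) (h q))"
proof -
  obtain V V' where V: "open V" "p \<in> V" "smooth_fun_on A V f" and V': "open V'" "p \<in> V'" "smooth_fun_on A V' h"
    using assms(2,3) unfolding smooth_fun_at_def by blast
  then have "smooth_fun_on A (V \<inter> V') f" "smooth_fun_on A (V \<inter> V') h"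
    using smooth_fun_on_subset by (meson Int_lower1 Int_lower2)+
  then show ?thesis using V V' assms(1)[of "V \<inter> V'" f h] by (intro smooth_fun_atI[of "V \<inter> V'"]) auto
qed

lemma
  assumes "smooth_fun_at A p f" "smooth_fun_at A p h"
  shows smooth_fun_at_add: "smooth_fun_at A p (\<lambda>q. f q + h q)"
    and smooth_fun_at_mult: "smooth_fun_at A p (\<lambda>q. f q * h q)"
    and smooth_fun_at_diff: "smooth_fun_at A p (\<lambda>q. f q - h q)"
  by (rule smooth_fun_at_binop[OF _ assms];
      rule smooth_fun_on_add smooth_fun_on_mult smooth_fun_on_diff; assumption)+

lemma smooth_fun_at_differentiable:
  assumes "smooth_fun_at A p f" "c \<in> A" "p \<in> fst c"
  shows "(f \<circ> chart_inv c) differentiable (at (snd c p))"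
proof -
  obtain V where "open V" "p \<in> V" "smooth_fun_on A V f"
    using assms(1) unfolding smooth_fun_at_def by blast
  then show ?thesis
    using smooth_on_differentiable open_chart_image assms unfolding smooth_fun_on_def by blast
qed

lemma frechet_derivative_chart_cong:
  assumes "open V" "p \<in> V" "\<And>q. q \<in> V \<Longrightarrow> f q = h q" "smooth_fun_at A p f" "c \<in> A" "p \<in> fst c"
  shows "frechet_derivative (f \<circ> chart_inv c) (at (snd c p)) = frechet_derivative (h \<circ> chart_inv c) (at (snd c p))"
proof (rule frechet_derivative_cong_open(2)[symmetric])
  show "open (snd c ` (fst c \<inter> V))" using open_chart_image[OF assms(5,1)] .
  show "snd c p \<in> snd c ` (fst c \<inter> V)" using assms by blast
  show "(f \<circ> chart_inv c) x = (h \<circ> chart_inv c) x" if "x \<in> snd c ` (fst c \<inter> V)" for x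
    using that assms(3) chart_inv_chart[OF assms(5)] by auto
  show "(f \<circ> chart_inv c) differentiable at (snd c p)"
    using smooth_fun_at_differentiable[OF assms(4-6)] .
qed

lemma smooth_fun_at_cong:
  assumes "open V" "p \<in> V" "\<And>q. q \<in> V \<Longrightarrow> f q = h q" "smooth_fun_at A p f"
  shows "smooth_fun_at A p h"
proof -
  obtain V' where V': "open V'" "p \<in> V'" "smooth_fun_on A V' f"
    using assms(4) unfolding smooth_fun_at_def by blast
  have "smooth_fun_on A (V \<inter> V') h"
    using smooth_fun_on_cong[of "V \<inter> V'" f h] smooth_fun_on_subset[of "V \<inter> V'" V' f] V' assms(1,3)
    by auto
  then show ?thesis using V' assms(1,2) by (intro smooth_fun_atI[of "V \<inter> V'"]) auto
qed

section \<open>Tangent spaces seen in a single chart\<close>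

definition chart_vector :: "('a, 'n) chart \<Rightarrow> 'a \<Rightarrow> real^'n \<Rightarrow> 'a tvec" where
  "chart_vector c p u = (\<lambda>f.
     if smooth_fun_at A p f then frechet_derivative (f \<circ> chart_inv c) (at (snd c p)) u else 0)"

text \<open>\<open>tangent_space\<close> admits vectors from every chart around p, so not even
  closure under sums is immediate. The chain rule along the transition map rewrites all of them in
  the chart d.\<close>

lemma tangent_space_chart:
  assumes d: "d \<in> A" "p \<in> fst d"
  shows "tangent_space A p = range (chart_vector d p)"
proof -
  have "\<exists>w. chart_vector c p u = chart_vector d p w" if c: "c \<in> A" "p \<in> fst c" for c u
  proof -
    define \<tau> where "\<tau> = snd d \<circ> chart_inv c"
    \<comment> \<open>The coordinates of the vector in d: the differential of the transition map
      applied to u.\<close>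
    define w where "w = frechet_derivative \<tau> (at (snd c p)) u"
    have o: "open (snd c ` (fst c \<inter> fst d))"
      using open_chart_image c d atlas unfolding smooth_atlas_def by blast
    have "smooth_on (snd c ` (fst c \<inter> fst d)) \<tau>"
      using atlas c d unfolding smooth_atlas_def \<tau>_def by blast
    then have \<tau>: "\<tau> differentiable (at (snd c p))"
      using smooth_on_differentiable o c d by blast
    have \<tau>p: "\<tau> (snd c p) = snd d p"
      using chart_inv_chart[OF c] by (simp add: \<tau>_def)
    have "frechet_derivative (f \<circ> chart_inv c) (at (snd c p)) u
        = frechet_derivative (f \<circ> chart_inv d) (at (snd d p)) w" if f: "smooth_fun_at A p f" for f
    proof -
      have fd: "(f \<circ> chart_inv d) differentiable (at (\<tau> (snd c p)))"
        using smooth_fun_at_differentiable[OF f d] \<tau>p by simp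
      have "((f \<circ> chart_inv d) \<circ> \<tau>) x = (f \<circ> chart_inv c) x" if "x \<in> snd c ` (fst c \<inter> fst d)" for x
        using that chart_inv_chart[OF c(1)] chart_inv_chart[OF d(1)] by (auto simp: \<tau>_def)
      from frechet_derivative_cong_open(2)[OF o _ this differentiable_chain_at[OF \<tau> fd]] c d
      have "frechet_derivative (f \<circ> chart_inv c) (at (snd c p))
          = frechet_derivative ((f \<circ> chart_inv d) \<circ> \<tau>) (at (snd c p))"
        by blast
      also have "\<dots> = frechet_derivative (f \<circ> chart_inv d) (at (\<tau> (snd c p))) \<circ> frechet_derivative \<tau> (at (snd c p))"
        by (rule frechet_derivative_compose[OF \<tau> fd])
      finally show ?thesis by (simp add: \<tau>p w_def)
    qed
    then show ?thesis unfolding chart_vector_def by (intro exI[of _ w]) auto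
  qed
  moreover have "tangent_space A p = (\<Union>c\<in>{c\<in>A. p \<in> fst c}. range (chart_vector c p))"
    unfolding tangent_space_def chart_vector_def by auto
  ultimately show ?thesis
  proof (intro equalityI subsetI)
    fix v assume "v \<in> tangent_space A p"
    then obtain c u where "c \<in> A" "p \<in> fst c" "v = chart_vector c p u"
      using \<open>tangent_space A p = _\<close> by blast
    with \<open>\<And>u c. c \<in> A \<Longrightarrow> p \<in> fst c \<Longrightarrow> \<exists>w. chart_vector c p u = chart_vector d p w\<close>
    obtain w where "v = chart_vector d p w" by metis
    then show "v \<in> range (chart_vector d p)" by simp
  qed (use d in blast)
qed

lemma chart_vector_linear:
  assumes "c \<in> A" "p \<in> fst c"
  shows "chart_vector c p (a *\<^sub>R u + b *\<^sub>R v) = (\<lambda>f. a * chart_vector c p u f + b * chart_vector c p v f)"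
proof
  fix f
  show "chart_vector c p (a *\<^sub>R u + b *\<^sub>R v) f = a * chart_vector c p u f + b * chart_vector c p v f"
  proof (cases "smooth_fun_at A p f")
    case True
    then have "linear (frechet_derivative (f \<circ> chart_inv c) (at (snd c p)))"
      using linear_frechet_derivative smooth_fun_at_differentiable assms by blast
    then show ?thesis using True by (simp add: chart_vector_def linear_add linear_scale)
  qed (simp add: chart_vector_def)
qed

lemma tangent_space_lincomb:
  assumes "u \<in> tangent_space A p" "v \<in> tangent_space A p"
  shows "(\<lambda>f. a * u f + b * v f) \<in> tangent_space A p"
proof -
  obtain c where c: "c \<in> A" "p \<in> fst c" using chart_at by blast
  then show ?thesis
    using assms unfolding tangent_space_chart[OF c]
    by (elim rangeE) (simp add: chart_vector_linear[OF c, symmetric])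
qed

lemma tangent_space_zero: "(\<lambda>f. 0) \<in> tangent_space A p"
proof -
  obtain c where c: "c \<in> A" "p \<in> fst c" using chart_at by blast
  then have "chart_vector c p 0 \<in> tangent_space A p" using tangent_space_chart by blast
  from tangent_space_lincomb[OF this this, of 0 0] show ?thesis by simp
qed

text \<open>Smoothness at p is a property of the germ. Either both functions have it, and their
  derivatives in a chart agree, or neither has it, and both values are the default 0.\<close>

lemma tangent_vector_cong:
  assumes "v \<in> tangent_space A p" "open V" "p \<in> V" "\<And>q. q \<in> V \<Longrightarrow> f q = h q"
  shows "v f = v h"
proof -
  obtain c u where c: "c \<in> A" "p \<in> fst c" and v: "v = chart_vector c p u"
    using assms(1) unfolding tangent_space_def chart_vector_def by blast
  show ?thesis
  proof (cases "smooth_fun_at A p f")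
    case True
    then show ?thesis
      using smooth_fun_at_cong[OF assms(2-4)] frechet_derivative_chart_cong[OF assms(2-4) True c]
      by (simp add: v chart_vector_def)
  next
    case False
    moreover have "\<not> smooth_fun_at A p h" 
      using False smooth_fun_at_cong[OF assms(2,3), of h f] assms(4) by auto
    ultimately show ?thesis by (simp add: v chart_vector_def)
  qed
qed

lemma tangent_vector_const: "v \<in> tangent_space A p \<Longrightarrow> v (\<lambda>q. a) = 0"
  unfolding tangent_space_def by (auto simp: comp_def)

lemma
  assumes "v \<in> tangent_space A p" "smooth_fun_at A p f" "smooth_fun_at A p h"
  shows tangent_vector_add: "v (\<lambda>q. f q + h q) = v f + v h"
    and tangent_vector_mult: "v (\<lambda>q. f q * h q) = v f * h p + f p * v h"
proof -
  obtain c u where c: "c \<in> A" "p \<in> fst c" and v: "v = chart_vector c p u"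
    using assms(1) unfolding tangent_space_def chart_vector_def by blast
  note d = smooth_fun_at_differentiable[OF assms(2) c] smooth_fun_at_differentiable[OF assms(3) c]
  show "v (\<lambda>q. f q + h q) = v f + v h"
    using frechet_derivative_add[OF d] smooth_fun_at_add[OF assms(2,3)] assms(2,3)
    by (simp add: v chart_vector_def comp_def)
  show "v (\<lambda>q. f q * h q) = v f * h p + f p * v h"
    using frechet_derivative_mult[OF d] smooth_fun_at_mult[OF assms(2,3)] assms(2,3) chart_inv_chart[OF c]
    by (simp add: v chart_vector_def comp_def)
qed

lemma tangent_vector_diff:
  assumes "v \<in> tangent_space A p" "smooth_fun_at A p f" "smooth_fun_at A p h"
  shows "v (\<lambda>q. f q - h q) = v f - v h"
  using tangent_vector_add[OF assms(1) smooth_fun_at_diff[OF assms(2,3)] assms(3)] by simp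

text \<open>A dimension count: the n vectors are independent because \<gamma> reads off their
  coefficients, and they span because the tangent space is the image of R^n under a chart.\<close>

lemma tangent_space_basis:
  fixes b :: "'n \<Rightarrow> 'a tvec" and \<gamma> :: "'a tvec \<Rightarrow> 'a tvec \<Rightarrow> real"
  assumes lin: "\<And>u v w a b. u \<in> tangent_space A p \<Longrightarrow> v \<in> tangent_space A p \<Longrightarrow> w \<in> tangent_space A p
        \<Longrightarrow> \<gamma> (\<lambda>f. a * u f + b * v f) w = a * \<gamma> u w + b * \<gamma> v w"
    and b: "\<And>i. b i \<in> tangent_space A p"
    and on: "\<And>i j. \<gamma> (b i) (b j) = (if i = j then 1 else 0)"
    and v: "v \<in> tangent_space A p"
  shows "v = (\<lambda>f. \<Sum>i\<in>UNIV. \<gamma> v (b i) * b i f)"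
proof -
  obtain c where c: "c \<in> A" "p \<in> fst c" using chart_at by blast
  let ?L = "chart_vector c p"
  have T: "tangent_space A p = range ?L" using tangent_space_chart[OF c] .
  have "\<forall>i. \<exists>x. ?L x = b i" using b unfolding T by (simp add: image_iff) (metis (no_types))
  then obtain u where u: "\<And>i. ?L (u i) = b i" by metis
  \<comment> \<open>Expressing the span as the range of an endomorphism of R^n lets injectivity
    imply surjectivity.\<close>
  define M where "M = (\<lambda>x :: real^'n. \<Sum>i\<in>UNIV. x $ i *\<^sub>R u i)"
  have Lzero: "?L 0 = (\<lambda>f. 0)" using chart_vector_linear[OF c, of 0 0 0 0] by simp
  have Lsum: "?L (\<Sum>i\<in>I. y i *\<^sub>R u i) = (\<lambda>f. \<Sum>i\<in>I. y i * b i f)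
      \<and> (\<forall>j. \<gamma> (?L (\<Sum>i\<in>I. y i *\<^sub>R u i)) (b j) = (if j \<in> I then y j else 0))" 
    if "finite I" for I y
    using that
  proof (induction I rule: finite_induct)
    case empty
    have "\<gamma> (\<lambda>f. 0) (b j) = 0" for j using lin[OF b b b, of 0 j 0 j j] by simp
    then show ?case using Lzero by simp
  next
    case (insert i I)
    let ?w = "\<Sum>i\<in>I. y i *\<^sub>R u i"
    have *: "?L (\<Sum>i\<in>insert i I. y i *\<^sub>R u i) = (\<lambda>f. y i * b i f + 1 * ?L ?w f)"
      using chart_vector_linear[OF c, of "y i" "u i" 1 ?w] insert by (simp add: u)
    have "\<gamma> (\<lambda>f. y i * b i f + 1 * ?L ?w f) (b j) = y i * \<gamma> (b i) (b j) + 1 * \<gamma> (?L ?w) (b j)" for j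
      by (rule lin[OF b _ b]) (simp add: T)
    then show ?case unfolding * using insert by (auto simp: on)
  qed
  have lM: "linear M"
    unfolding M_def by (rule linearI) (simp_all add: scaleR_add_left sum.distrib scaleR_sum_right)
  have "inj M"
  proof (rule linear_injective_0[THEN iffD2, OF lM, rule_format])
    fix x assume "M x = 0"
    then have "?L (\<Sum>i\<in>UNIV. x $ i *\<^sub>R u i) = (\<lambda>f. 0)" using Lzero by (simp add: M_def)
    moreover have "\<gamma> (\<lambda>f. 0) (b j) = 0" for j using lin[OF b b b, of 0 j 0 j j] by simp
    moreover have "\<gamma> (?L (\<Sum>i\<in>UNIV. x $ i *\<^sub>R u i)) (b j) = x $ j" for j
      using conjunct2[OF Lsum[of UNIV "\<lambda>i. x $ i"]] by simp
    ultimately have "x $ j = 0" for j by metis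
    then show "x = 0" by (simp add: vec_eq_iff)
  qed
  then have "surj M" using lM linear_injective_imp_surjective by blast
  moreover obtain w where w: "v = ?L w" using v T by auto
  ultimately obtain x where "w = M x" unfolding surj_def by blast
  then have v: "v = ?L (\<Sum>i\<in>UNIV. x $ i *\<^sub>R u i)" using w by (simp add: M_def)
  have L: "?L (\<Sum>i\<in>UNIV. x $ i *\<^sub>R u i) = (\<lambda>f. \<Sum>i\<in>UNIV. x $ i * b i f)"
    and \<gamma>: "\<gamma> (?L (\<Sum>i\<in>UNIV. x $ i *\<^sub>R u i)) (b j) = x $ j" for j
    using conjunct2[OF Lsum[of UNIV "\<lambda>i. x $ i"]]
    by (simp_all only: conjunct1[OF Lsum[of UNIV "\<lambda>i. x $ i"]] finite UNIV_I if_True)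
  show ?thesis unfolding v \<gamma> by (rule L)
qed

end

section \<open>Vector fields and the Levi-Civita connection\<close>

lemma vf_add_apply [simp]: "vf_add X Y p f = X p f + Y p f"
  and vf_diff_apply [simp]: "vf_diff X Y p f = X p f - Y p f"
  and vf_scale_apply [simp]: "vf_scale h X p f = h p * X p f"
  by (simp_all add: vf_add_def vf_diff_def vf_scale_def)

locale levi_civita_on = manifold A
  for A :: "('a::{t2_space, second_countable_topology}, 'n::finite) chart set" +
  fixes g :: "'a metric" and D :: "'a connection" and U :: "'a set"
  assumes metric: "riemannian_metric A g"
    and connection: "levi_civita_connection A g D"
    and open_U: "open U"
begin

abbreviation VF :: "'a vfield \<Rightarrow> bool" where "VF \<equiv> vector_field_on A U"
abbreviation SF :: "('a \<Rightarrow> real) \<Rightarrow> bool" where "SF \<equiv> smooth_fun_on A U"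
abbreviation lie :: "'a vfield \<Rightarrow> 'a vfield \<Rightarrow> 'a vfield" where "lie \<equiv> lie_bracket A"
abbreviation curv :: "'a vfield \<Rightarrow> 'a vfield \<Rightarrow> 'a vfield \<Rightarrow> 'a vfield" where "curv \<equiv> curvature A D"

lemma VF_tangent: "VF X \<Longrightarrow> p \<in> U \<Longrightarrow> X p \<in> tangent_space A p"
  unfolding vector_field_on_def by blast

lemma VF_smooth: "VF X \<Longrightarrow> open V \<Longrightarrow> V \<subseteq> U \<Longrightarrow> smooth_fun_on A V f \<Longrightarrow> smooth_fun_on A V (\<lambda>p. X p f)"
  unfolding vector_field_on_def by blast

lemma SF_VF: "VF X \<Longrightarrow> SF f \<Longrightarrow> SF (\<lambda>p. X p f)"
  using VF_smooth open_U by blast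

lemma VFI:
  assumes "\<And>p. p \<in> U \<Longrightarrow> X p \<in> tangent_space A p"
    and "\<And>V f. open V \<Longrightarrow> V \<subseteq> U \<Longrightarrow> smooth_fun_on A V f \<Longrightarrow> smooth_fun_on A V (\<lambda>p. X p f)"
  shows "VF X"
  using assms unfolding vector_field_on_def by blast

lemma VF_cong:
  assumes "VF X" "\<And>q. q \<in> U \<Longrightarrow> X q = Y q"
  shows "VF Y"
proof (rule VFI)
  show "Y p \<in> tangent_space A p" if "p \<in> U" for p using VF_tangent[OF assms(1)] assms(2) that by metis
  show "smooth_fun_on A V (\<lambda>p. Y p f)" if "open V" "V \<subseteq> U" "smooth_fun_on A V f" for V f
    by (rule smooth_fun_on_cong[OF that(1) _ VF_smooth[OF assms(1) that]]) (use assms(2) that in auto)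
qed

lemma VF_add [intro]: assumes "VF X" "VF Y" shows "VF (vf_add X Y)"
proof (rule VFI)
  show "vf_add X Y p \<in> tangent_space A p" if "p \<in> U" for p
    using tangent_space_lincomb[OF VF_tangent[OF assms(1) that] VF_tangent[OF assms(2) that], of 1 1]
    by (simp add: vf_add_def)
  show "smooth_fun_on A V (\<lambda>p. vf_add X Y p f)" if "open V" "V \<subseteq> U" "smooth_fun_on A V f" for V f
    by (simp add: smooth_fun_on_add that(1) VF_smooth[OF assms(1) that] VF_smooth[OF assms(2) that])
qed

lemma VF_scale [intro]: assumes "SF h" "VF X" shows "VF (vf_scale h X)"
proof (rule VFI)
  show "vf_scale h X p \<in> tangent_space A p" if "p \<in> U" for p
    using tangent_space_lincomb[OF VF_tangent[OF assms(2) that] VF_tangent[OF assms(2) that], of "h p" 0]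
    by (simp add: vf_scale_def)
  show "smooth_fun_on A V (\<lambda>p. vf_scale h X p f)" if "open V" "V \<subseteq> U" "smooth_fun_on A V f" for V f
    by (simp add: smooth_fun_on_mult that(1) smooth_fun_on_subset[OF that(2) assms(1)] VF_smooth[OF assms(2) that])
qed

lemma VF_diff [intro]: assumes "VF X" "VF Y" shows "VF (vf_diff X Y)"
proof -
  have "vf_diff X Y = vf_add X (vf_scale (\<lambda>q. -1) Y)"
    by (simp add: vf_diff_def vf_add_def vf_scale_def)
  then show ?thesis using assms VF_add VF_scale smooth_fun_on_const by metis
qed

lemma VF_zero [intro]: "VF (\<lambda>p f. 0)"
  by (rule VFI) (simp_all add: tangent_space_zero smooth_fun_on_const)

lemma SF_at: "SF f \<Longrightarrow> p \<in> U \<Longrightarrow> smooth_fun_at A p f"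
  using smooth_fun_atI open_U by blast

lemma VF_smooth_at:
  assumes "VF X" "p \<in> U" "smooth_fun_at A p f"
  shows "smooth_fun_at A p (\<lambda>q. X q f)"
proof -
  obtain V where "open V" "p \<in> V" "smooth_fun_on A V f"
    using assms(3) unfolding smooth_fun_at_def by blast
  then have "smooth_fun_on A (U \<inter> V) (\<lambda>q. X q f)"
    using VF_smooth[OF assms(1), of "U \<inter> V" f] smooth_fun_on_subset[of "U \<inter> V" V f] open_U by auto
  then show ?thesis using \<open>open V\<close> \<open>p \<in> V\<close> assms(2) open_U by (intro smooth_fun_atI[of "U \<inter> V"]) auto
qed

context
  fixes p X assumes p: "p \<in> U" and X: "VF X"
begin

lemma VF_apply_cong: "(\<And>q. q \<in> U \<Longrightarrow> f q = h q) \<Longrightarrow> X p f = X p h"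
  by (rule tangent_vector_cong[OF VF_tangent[OF X p] open_U p])

lemma VF_apply_add: "SF f \<Longrightarrow> SF h \<Longrightarrow> X p (\<lambda>q. f q + h q) = X p f + X p h"
  by (intro tangent_vector_add[OF VF_tangent[OF X p]] SF_at p)

lemma VF_apply_diff: "SF f \<Longrightarrow> SF h \<Longrightarrow> X p (\<lambda>q. f q - h q) = X p f - X p h"
  by (intro tangent_vector_diff[OF VF_tangent[OF X p]] SF_at p)

lemma VF_apply_mult: "SF f \<Longrightarrow> SF h \<Longrightarrow> X p (\<lambda>q. f q * h q) = X p f * h p + f p * X p h"
  by (intro tangent_vector_mult[OF VF_tangent[OF X p]] SF_at p)

lemma VF_apply_const: "X p (\<lambda>q. a) = 0"
  using tangent_vector_const[OF VF_tangent[OF X p]] .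

lemma VF_apply_sum:
  assumes "\<And>i. i \<in> I \<Longrightarrow> SF (f i)"
  shows "X p (\<lambda>q. \<Sum>i\<in>I. f i q) = (\<Sum>i\<in>I. X p (f i))"
  using assms
proof (induction I rule: infinite_finite_induct)
  case (insert i I)
  then show ?case by (simp add: VF_apply_add smooth_fun_on_sum[OF open_U])
qed (simp_all add: VF_apply_const)

end

lemma SF_diff: "SF f \<Longrightarrow> SF h \<Longrightarrow> SF (\<lambda>q. f q - h q)"
  and SF_mult: "SF f \<Longrightarrow> SF h \<Longrightarrow> SF (\<lambda>q. f q * h q)"
  and SF_const: "SF (\<lambda>q. a)"
  by (intro smooth_fun_on_diff[OF open_U] smooth_fun_on_mult[OF open_U]
      smooth_fun_on_const; assumption)+

lemma SF_sum: "(\<And>i. i \<in> I \<Longrightarrow> SF (f i)) \<Longrightarrow> SF (\<lambda>q. \<Sum>i\<in>I. f i q)"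
  by (rule smooth_fun_on_sum[OF open_U])

lemma SF_cong: "SF f \<Longrightarrow> (\<And>q. q \<in> U \<Longrightarrow> f q = h q) \<Longrightarrow> SF h"
  by (rule smooth_fun_on_cong[OF open_U])

subsection \<open>Function-linear functionals on vector fields\<close>

text \<open>Tensoriality of one argument at p: scaling is by functions, with the factor evaluated at
  p. With an orthonormal frame on U this makes the functional depend on \<open>X p\<close> alone, as
  \<open>linear_at_frame\<close> shows.\<close>

definition linear_at :: "'a \<Rightarrow> ('a vfield \<Rightarrow> real) \<Rightarrow> bool" where
  "linear_at p \<Phi> \<longleftrightarrow> (\<forall>X Y. VF X \<longrightarrow> VF Y \<longrightarrow> \<Phi> (vf_add X Y) = \<Phi> X + \<Phi> Y) \<and>
     (\<forall>h X. SF h \<longrightarrow> VF X \<longrightarrow> \<Phi> (vf_scale h X) = h p * \<Phi> X)"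

lemma linear_atI:
  assumes "\<And>X Y. VF X \<Longrightarrow> VF Y \<Longrightarrow> \<Phi> (vf_add X Y) = \<Phi> X + \<Phi> Y"
    and "\<And>h X. SF h \<Longrightarrow> VF X \<Longrightarrow> \<Phi> (vf_scale h X) = h p * \<Phi> X"
  shows "linear_at p \<Phi>"
  using assms unfolding linear_at_def by blast

lemma linear_at_add: "linear_at p \<Phi> \<Longrightarrow> VF X \<Longrightarrow> VF Y \<Longrightarrow> \<Phi> (vf_add X Y) = \<Phi> X + \<Phi> Y"
  and linear_at_scale: "linear_at p \<Phi> \<Longrightarrow> SF h \<Longrightarrow> VF X \<Longrightarrow> \<Phi> (vf_scale h X) = h p * \<Phi> X"
  unfolding linear_at_def by blast+

text \<open>Locality comes for free: the indicator of the complement of \<open>U\<close> is smooth on \<open>U\<close>, and it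
  leaves a field that vanishes on \<open>U\<close> unchanged.\<close>

lemma vanishing_field:
  assumes "\<And>q. q \<in> U \<Longrightarrow> Z q = (\<lambda>f. 0)"
  shows "\<exists>h. SF h \<and> (\<forall>q\<in>U. h q = 0) \<and> vf_scale h Z = Z"
proof (intro exI conjI)
  show "SF (\<lambda>q. if q \<in> U then 0 else 1)"
    by (rule SF_cong[OF SF_const[of 0]]) simp
  show "vf_scale (\<lambda>q. if q \<in> U then 0 else 1) Z = Z"
    using assms by (auto simp: vf_scale_def)
qed simp

lemma vf_add_diff: "vf_add X (vf_diff Y X) = Y"
  by (simp add: vf_add_def vf_diff_def)

lemma linear_at_zero:
  assumes "linear_at p \<Phi>" "p \<in> U" "\<And>q. q \<in> U \<Longrightarrow> Z q = (\<lambda>f. 0)"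
  shows "\<Phi> Z = 0"
proof -
  obtain h where h: "SF h" "\<And>q. q \<in> U \<Longrightarrow> h q = 0" "vf_scale h Z = Z"
    using vanishing_field[of Z] assms(3) by blast
  have "VF Z" using VF_cong[OF VF_zero] assms(3) by metis
  then show ?thesis using linear_at_scale[OF assms(1) h(1), of Z] h assms(2) by simp
qed

text \<open>\<open>linear_at\<close> speaks of fields as total functions, so insensitivity to values
  outside U has to be derived: Y is literally the sum of X and a field vanishing on U.\<close>

lemma linear_at_cong:
  assumes "linear_at p \<Phi>" "p \<in> U" "VF X" "\<And>q. q \<in> U \<Longrightarrow> X q = Y q"
  shows "\<Phi> X = \<Phi> Y"
proof -
  have "VF Y" using VF_cong[OF assms(3,4)] .
  then have "\<Phi> (vf_add X (vf_diff Y X)) = \<Phi> X + \<Phi> (vf_diff Y X)"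
    using linear_at_add assms by blast
  moreover have "\<Phi> (vf_diff Y X) = 0"
    by (rule linear_at_zero[OF assms(1,2)]) (simp add: assms(4) vf_diff_def)
  ultimately show ?thesis by (simp add: vf_add_diff)
qed

lemma linear_at_diff:
  assumes "linear_at p \<Phi>" "VF X" "VF Y"
  shows "\<Phi> (vf_diff X Y) = \<Phi> X - \<Phi> Y"
  using linear_at_add[OF assms(1,3) VF_diff[OF assms(2,3)]] by (simp add: vf_add_diff)

lemma linear_at_sum:
  assumes "\<And>i. i \<in> I \<Longrightarrow> linear_at p (\<Phi> i)"
  shows "linear_at p (\<lambda>X. \<Sum>i\<in>I. \<Phi> i X)"
  by (rule linear_atI)
    (simp_all add: linear_at_add[OF assms] linear_at_scale[OF assms] sum.distrib sum_distrib_left)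

lemma linear_at_mult_right: "linear_at p \<Phi> \<Longrightarrow> linear_at p (\<lambda>X. \<Phi> X * a)"
  and linear_at_mult_left: "linear_at p \<Phi> \<Longrightarrow> linear_at p (\<lambda>X. a * \<Phi> X)"
  by (simp_all add: linear_at_def algebra_simps)

lemma linear_at_minus: "linear_at p \<Phi> \<Longrightarrow> linear_at p \<Psi> \<Longrightarrow> linear_at p (\<lambda>X. \<Phi> X - \<Psi> X)"
  by (simp add: linear_at_def algebra_simps)

subsection \<open>The metric\<close>

lemma SF_metric: "VF X \<Longrightarrow> VF Y \<Longrightarrow> SF (\<lambda>p. g p (X p) (Y p))"
  using conjunct2[OF conjunct2[OF conjunct2[OF metric[unfolded riemannian_metric_def]]], rule_format, of U X Y]
    open_U by simp

lemma metric_lincomb: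
  assumes "u \<in> tangent_space A p" "v \<in> tangent_space A p" "w \<in> tangent_space A p"
  shows "g p (\<lambda>f. a * u f + b * v f) w = a * g p u w + b * g p v w"
  using conjunct1[OF metric[unfolded riemannian_metric_def], rule_format, of u p v w a b] assms by simp

lemma metric_sym: "p \<in> U \<Longrightarrow> VF X \<Longrightarrow> VF Y \<Longrightarrow> g p (X p) (Y p) = g p (Y p) (X p)"
  using conjunct1[OF conjunct2[OF metric[unfolded riemannian_metric_def]], rule_format, of "X p" p "Y p"]
    VF_tangent by simp

lemma linear_at_metric_left:
  assumes "p \<in> U" "VF Y"
  shows "linear_at p (\<lambda>X. g p (X p) (Y p))"
proof (rule linear_atI)
  show "g p (vf_add X X' p) (Y p) = g p (X p) (Y p) + g p (X' p) (Y p)" if "VF X" "VF X'" for X X'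
    using metric_lincomb[of "X p" p "X' p" "Y p" 1 1] that assms VF_tangent by (simp add: vf_add_def)
  show "g p (vf_scale h X p) (Y p) = h p * g p (X p) (Y p)" if "VF X" for h X
    using metric_lincomb[of "X p" p "X p" "Y p" "h p" 0] that assms VF_tangent by (simp add: vf_scale_def)
qed

lemma linear_at_metric_right:
  assumes "p \<in> U" "VF Y"
  shows "linear_at p (\<lambda>X. g p (Y p) (X p))"
proof (rule linear_atI)
  fix X X' h assume X: "VF X"
  show "g p (Y p) (vf_scale h X p) = h p * g p (Y p) (X p)" if "SF h"
    using linear_at_scale[OF linear_at_metric_left[OF assms] that X] metric_sym[OF assms(1) X assms(2)]
      metric_sym[OF assms(1) VF_scale[OF that X] assms(2)] by simp
  assume X': "VF X'"
  show "g p (Y p) (vf_add X X' p) = g p (Y p) (X p) + g p (Y p) (X' p)"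
    using linear_at_add[OF linear_at_metric_left[OF assms] X X'] metric_sym[OF assms(1) X assms(2)]
      metric_sym[OF assms(1) X' assms(2)] metric_sym[OF assms(1) VF_add[OF X X'] assms(2)] by simp
qed

subsection \<open>The Levi-Civita connection\<close>

lemma connection_props:
  assumes "VF X" "VF Y" "VF Z" "SF h"
  shows "VF (D X Y)"
    and "p \<in> U \<Longrightarrow> D (vf_add X Y) Z p = vf_add (D X Z) (D Y Z) p"
    and "p \<in> U \<Longrightarrow> D (vf_scale h X) Y p = vf_scale h (D X Y) p"
    and "p \<in> U \<Longrightarrow> D X (vf_add Y Z) p = vf_add (D X Y) (D X Z) p"
    and "p \<in> U \<Longrightarrow> D X (vf_scale h Y) p = vf_add (vf_scale (\<lambda>q. X q h) Y) (vf_scale h (D X Y)) p"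
    and "p \<in> U \<Longrightarrow> X p (\<lambda>q. g q (Y q) (Z q)) = g p (D X Y p) (Z p) + g p (Y p) (D X Z p)"
    and "p \<in> U \<Longrightarrow> vf_diff (D X Y) (D Y X) p = lie X Y p"
proof -
  have "VF (D X Y) \<and> (\<forall>p\<in>U.
          D (vf_add X Y) Z p = vf_add (D X Z) (D Y Z) p \<and>
          D (vf_scale h X) Y p = vf_scale h (D X Y) p \<and>
          D X (vf_add Y Z) p = vf_add (D X Y) (D X Z) p \<and>
          D X (vf_scale h Y) p = vf_add (vf_scale (\<lambda>q. X q h) Y) (vf_scale h (D X Y)) p \<and>
          X p (\<lambda>q. g q (Y q) (Z q)) = g p (D X Y p) (Z p) + g p (Y p) (D X Z p) \<and>
          vf_diff (D X Y) (D Y X) p = lie X Y p)"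
    by (rule connection[unfolded levi_civita_connection_def, rule_format, of U]) (simp add: assms open_U)
  note c = conjunct1[OF this] conjunct2[OF this, rule_format]
  show "VF (D X Y)" by (rule c(1))
  assume p: "p \<in> U"
  note d = c(2)[OF p]
  show "D (vf_add X Y) Z p = vf_add (D X Z) (D Y Z) p" using d by (elim conjE)
  show "D (vf_scale h X) Y p = vf_scale h (D X Y) p" using d by (elim conjE)
  show "D X (vf_add Y Z) p = vf_add (D X Y) (D X Z) p" using d by (elim conjE)
  show "D X (vf_scale h Y) p = vf_add (vf_scale (\<lambda>q. X q h) Y) (vf_scale h (D X Y)) p"
    using d by (elim conjE)
  show "X p (\<lambda>q. g q (Y q) (Z q)) = g p (D X Y p) (Z p) + g p (Y p) (D X Z p)"
    using d by (elim conjE)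
  show "vf_diff (D X Y) (D Y X) p = lie X Y p" using d by (elim conjE)
qed

lemma VF_D [intro]: "VF X \<Longrightarrow> VF Y \<Longrightarrow> VF (D X Y)"
  using connection_props(1)[OF _ _ _ SF_const] .

lemma linear_at_D: assumes "p \<in> U" "VF Y" shows "linear_at p (\<lambda>X. D X Y p f)"
  by (rule linear_atI) (simp_all add: connection_props(2)[OF _ _ _ SF_const[of 0]]
      connection_props(3) assms)

context
  fixes p X assumes p: "p \<in> U" and X: "VF X"
begin

lemma D_add_right: "VF Y \<Longrightarrow> VF Z \<Longrightarrow> D X (vf_add Y Z) p = vf_add (D X Y) (D X Z) p"
  using connection_props(4)[OF X _ _ SF_const p] .

lemma D_scale_right:
  "SF h \<Longrightarrow> VF Y \<Longrightarrow> D X (vf_scale h Y) p = vf_add (vf_scale (\<lambda>q. X q h) Y) (vf_scale h (D X Y)) p"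
  using connection_props(5)[OF X _ _ _ p] by blast

lemma D_metric:
  "VF Y \<Longrightarrow> VF Z \<Longrightarrow> X p (\<lambda>q. g q (Y q) (Z q)) = g p (D X Y p) (Z p) + g p (Y p) (D X Z p)"
  using connection_props(6)[OF X _ _ SF_const p] .

lemma D_torsion: "VF Y \<Longrightarrow> lie X Y p = vf_diff (D X Y) (D Y X) p"
  using connection_props(7)[OF X _ X SF_const p] by simp

text \<open>Differentiation is not function-linear in Z, so \<open>linear_at_zero\<close> does not
  apply. With Z = h Z and h zero on U, the Leibniz rule gives X(h) Z + h \<open>D X Z\<close>, and
  both terms vanish at p.\<close>

lemma D_zero_right:
  assumes "\<And>q. q \<in> U \<Longrightarrow> Z q = (\<lambda>f. 0)"
  shows "D X Z p = (\<lambda>f. 0)"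
proof -
  obtain h where h: "SF h" "\<And>q. q \<in> U \<Longrightarrow> h q = 0" "vf_scale h Z = Z"
    using vanishing_field[of Z] assms by blast
  have "VF Z" using VF_cong[OF VF_zero] assms by metis
  then have "D X Z p = vf_add (vf_scale (\<lambda>q. X q h) Z) (vf_scale h (D X Z)) p"
    using D_scale_right[OF h(1), of Z] h(3) by simp
  then show ?thesis using h(2) assms p by (simp add: vf_add_def vf_scale_def)
qed

lemma D_diff_right: "VF Y \<Longrightarrow> VF Z \<Longrightarrow> D X (vf_diff Y Z) p = vf_diff (D X Y) (D X Z) p"
  using D_add_right[of Z "vf_diff Y Z"] VF_diff[of Y Z] by (auto simp: vf_add_diff fun_eq_iff)

lemma D_cong_right:
  assumes "VF Y" "\<And>q. q \<in> U \<Longrightarrow> Y q = Y' q"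
  shows "D X Y p = D X Y' p"
proof -
  have Y': "VF Y'" using VF_cong[OF assms] .
  have "D X (vf_diff Y Y') p = (\<lambda>f. 0)"
    by (rule D_zero_right) (simp add: assms vf_diff_def)
  then show ?thesis using D_diff_right[OF assms(1) Y'] by (auto simp: fun_eq_iff)
qed

end

lemma D_cong:
  assumes "p \<in> U" "VF X" "VF Y" "\<And>q. q \<in> U \<Longrightarrow> X q = X' q" "\<And>q. q \<in> U \<Longrightarrow> Y q = Y' q"
  shows "D X Y p = D X' Y' p"
proof -
  have "D X Y p = D X Y' p" using D_cong_right assms by blast
  also have "\<dots> = D X' Y' p"
    using linear_at_cong[OF linear_at_D[OF assms(1)] assms(1,2,4)] VF_cong[OF assms(3,5)] by blast
  finally show ?thesis .
qed

lemma D_diff_left: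
  "p \<in> U \<Longrightarrow> VF X \<Longrightarrow> VF Y \<Longrightarrow> VF Z \<Longrightarrow> D (vf_diff X Y) Z p f = D X Z p f - D Y Z p f"
  by (rule linear_at_diff[OF linear_at_D])

text \<open>Torsion-freeness identifies the bracket on U with a difference of covariant derivatives;
  this replaces a computation with second derivatives in charts.\<close>

lemma VF_lie [intro]: assumes "VF X" "VF Y" shows "VF (lie X Y)"
  by (rule VF_cong[OF VF_diff[OF VF_D[OF assms] VF_D[OF assms(2,1)]]]) (rule D_torsion[OF _ assms, symmetric])

lemma D_lie_left:
  assumes "p \<in> U" "VF X" "VF Y" "VF Z"
  shows "D (lie X Y) Z p f = D (D X Y) Z p f - D (D Y X) Z p f"
proof -
  have "D (lie X Y) Z p = D (vf_diff (D X Y) (D Y X)) Z p"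
    by (rule D_cong[OF assms(1) VF_lie[OF assms(2,3)] assms(4) D_torsion[OF _ assms(2,3)] refl])
  then show ?thesis by (simp add: D_diff_left[OF assms(1) VF_D VF_D] assms)
qed

lemma D_lie_right:
  assumes "p \<in> U" "VF X" "VF Y" "VF Z"
  shows "D X (lie Y Z) p f = D X (D Y Z) p f - D X (D Z Y) p f"
proof -
  have "D X (lie Y Z) p = D X (vf_diff (D Y Z) (D Z Y)) p"
    by (rule D_cong[OF assms(1,2) VF_lie[OF assms(3,4)] refl D_torsion[OF _ assms(3,4)]])
  then show ?thesis by (simp add: D_diff_right[OF assms(1,2) VF_D VF_D] assms)
qed

section \<open>Lie brackets on germs and the Jacobi identity\<close>

lemma lie_apply: "smooth_fun_at A p f \<Longrightarrow> lie X Y p f = X p (\<lambda>q. Y q f) - Y p (\<lambda>q. X q f)"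
  by (simp add: lie_bracket_def)

text \<open>As f is smooth only near p, the bracket can be unfolded only on a neighbourhood V of p,
  which is all that a derivation at p sees.\<close>

lemma VF_apply_lie:
  assumes "p \<in> U" "VF X" "VF Y" "VF Z" "smooth_fun_at A p f"
  shows "X p (\<lambda>q. lie Y Z q f) = X p (\<lambda>q. Y q (\<lambda>r. Z r f)) - X p (\<lambda>q. Z q (\<lambda>r. Y r f))"
proof -
  obtain V where V: "open V" "p \<in> V" "smooth_fun_on A V f"
    using assms(5) unfolding smooth_fun_at_def by blast
  have "X p (\<lambda>q. lie Y Z q f) = X p (\<lambda>q. Y q (\<lambda>r. Z r f) - Z q (\<lambda>r. Y r f))"
    by (rule tangent_vector_cong[OF VF_tangent[OF assms(2,1)] V(1,2)])
      (rule lie_apply[OF smooth_fun_atI[OF V(1) _ V(3)]])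
  also have "\<dots> = X p (\<lambda>q. Y q (\<lambda>r. Z r f)) - X p (\<lambda>q. Z q (\<lambda>r. Y r f))"
    by (rule tangent_vector_diff[OF VF_tangent[OF assms(2,1)]
          VF_smooth_at[OF assms(3,1) VF_smooth_at[OF assms(4,1,5)]]
          VF_smooth_at[OF assms(4,1) VF_smooth_at[OF assms(3,1,5)]]])
  finally show ?thesis .
qed

text \<open>On functions smooth near p the triple derivatives cancel cyclically; on all others the
  three brackets have the default value 0. Thus the identity is one of tangent vectors as
  functions.\<close>

lemma jacobi:
  assumes "p \<in> U" "VF X" "VF Y" "VF Z"
  shows "lie X (lie Y Z) p f + lie Y (lie Z X) p f + lie Z (lie X Y) p f = 0"
proof (cases "smooth_fun_at A p f")
  case True
  have "lie X (lie Y Z) p f = X p (\<lambda>q. Y q (\<lambda>r. Z r f)) - X p (\<lambda>q. Z q (\<lambda>r. Y r f))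
      - (Y p (\<lambda>q. Z q (\<lambda>r. X r f)) - Z p (\<lambda>q. Y q (\<lambda>r. X r f)))"
    if "VF X" "VF Y" "VF Z" for X Y Z
    using VF_apply_lie[OF assms(1) that True] lie_apply[OF True, of X "lie Y Z"]
      lie_apply[OF VF_smooth_at[OF that(1) assms(1) True], of Y Z]
    by simp
  from this[of X Y Z] this[of Y Z X] this[of Z X Y] assms show ?thesis by simp
qed (simp add: lie_bracket_def)

subsection \<open>Curvature\<close>

lemma curv_apply: "curv X Y Z p f = D X (D Y Z) p f - D Y (D X Z) p f - D (lie X Y) Z p f"
  by (simp add: curvature_def)

lemma VF_curv [intro]: "VF X \<Longrightarrow> VF Y \<Longrightarrow> VF Z \<Longrightarrow> VF (curv X Y Z)"
  unfolding curvature_def by blast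

lemma curv_eq:
  assumes "p \<in> U" "VF X" "VF Y" "VF Z"
  shows "curv X Y Z p f = D X (D Y Z) p f - D Y (D X Z) p f - D (D X Y) Z p f + D (D Y X) Z p f"
  using D_lie_left[OF assms] by (simp add: curv_apply)

lemma curv_swap:
  assumes "p \<in> U" "VF X" "VF Y" "VF Z"
  shows "curv X Y Z p f = - curv Y X Z p f"
  using curv_eq assms by simp

text \<open>The Jacobi identity with every bracket replaced by the antisymmetrised covariant
  derivative.\<close>

lemma first_bianchi:
  assumes "p \<in> U" "VF X" "VF Y" "VF Z"
  shows "curv X Y Z p f + curv Y Z X p f + curv Z X Y p f = 0"
  using jacobi[OF assms, of f] assms
  by (simp add: curv_eq D_torsion VF_lie D_lie_left D_lie_right)

text \<open>For scaling by h, the term with Y(h) from \<open>D Y (D (vf_scale h X) Z)\<close>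
  cancels the one from \<open>D (D Y (vf_scale h X)) Z\<close>.\<close>

lemma linear_at_curv1:
  assumes "p \<in> U" "VF Y" "VF Z"
  shows "linear_at p (\<lambda>X. curv X Y Z p f)"
proof (rule linear_atI)
  fix X X' assume X: "VF X" "VF X'"
  have 1: "D Y (D (vf_add X X') Z) p f = D Y (D X Z) p f + D Y (D X' Z) p f"
  proof -
    have "D Y (D (vf_add X X') Z) p = D Y (vf_add (D X Z) (D X' Z)) p"
      by (rule D_cong) (use assms X connection_props(2)[OF _ _ _ SF_const] in auto)
    then show ?thesis using D_add_right[OF assms(1,2), of "D X Z" "D X' Z"] assms X VF_D by simp
  qed
  have 2: "D (D (vf_add X X') Y) Z p = D (vf_add (D X Y) (D X' Y)) Z p"
    by (rule D_cong) (use assms X connection_props(2)[OF _ _ _ SF_const] in auto)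
  have 3: "D (D Y (vf_add X X')) Z p = D (vf_add (D Y X) (D Y X')) Z p"
    by (rule D_cong) (use assms X D_add_right in auto)
  note L = linear_at_add[OF linear_at_D[OF assms(1)]]
  show "curv (vf_add X X') Y Z p f = curv X Y Z p f + curv X' Y Z p f"
    using assms X by (simp add: curv_eq VF_add VF_D 1 2 3 L)
next
  fix X h assume X: "VF X" and h: "SF h"
  have 1: "D Y (D (vf_scale h X) Z) p f = Y p h * D X Z p f + h p * D Y (D X Z) p f"
  proof -
    have "D Y (D (vf_scale h X) Z) p = D Y (vf_scale h (D X Z)) p"
      by (rule D_cong) (use assms X h connection_props(3)[OF _ _ _ h] in auto)
    then show ?thesis using D_scale_right[OF assms(1,2) h, of "D X Z"] assms X VF_D by simp
  qed
  have 2: "D (D (vf_scale h X) Y) Z p = D (vf_scale h (D X Y)) Z p"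
    by (rule D_cong) (use assms X h connection_props(3)[OF _ _ _ h] in auto)
  have 3: "D (D Y (vf_scale h X)) Z p = D (vf_add (vf_scale (\<lambda>q. Y q h) X) (vf_scale h (D Y X))) Z p"
    by (rule D_cong) (use assms X h D_scale_right in auto)
  note L = linear_at_add[OF linear_at_D[OF assms(1)]] linear_at_scale[OF linear_at_D[OF assms(1)]]
  show "curv (vf_scale h X) Y Z p f = h p * curv X Y Z p f"
    using assms X h by (simp add: curv_eq VF_add VF_D VF_scale SF_VF 1 2 3 L algebra_simps)
qed

lemma linear_at_curv2:
  assumes "p \<in> U" "VF X" "VF Z"
  shows "linear_at p (\<lambda>Y. curv X Y Z p f)"
proof (rule linear_atI)
  note L = linear_at_curv1[OF assms, of f] and swap = curv_swap[OF assms(1,2) _ assms(3), of _ f]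
  show "curv X (vf_add Y Y') Z p f = curv X Y Z p f + curv X Y' Z p f" if "VF Y" "VF Y'" for Y Y'
    using linear_at_add[OF L that] swap[OF VF_add[OF that]] swap[OF that(1)] swap[OF that(2)] by simp
  show "curv X (vf_scale h Y) Z p f = h p * curv X Y Z p f" if "SF h" "VF Y" for h Y
    using linear_at_scale[OF L that] swap[OF VF_scale[OF that]] swap[OF that(2)] by simp
qed

lemma linear_at_curv3:
  assumes "p \<in> U" "VF X" "VF Y"
  shows "linear_at p (\<lambda>Z. curv X Y Z p f)"
proof (rule linear_atI)
  fix Z Z' assume Z: "VF Z" "VF Z'"
  have 1: "D X (D Y (vf_add Z Z')) p f = D X (D Y Z) p f + D X (D Y Z') p f" if "VF X" "VF Y" for X Y
  proof -
    have "D X (D Y (vf_add Z Z')) p = D X (vf_add (D Y Z) (D Y Z')) p"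
      by (rule D_cong) (use assms(1) that Z D_add_right in auto)
    then show ?thesis using D_add_right[OF assms(1) that(1), of "D Y Z" "D Y Z'"] that Z VF_D by simp
  qed
  show "curv X Y (vf_add Z Z') p f = curv X Y Z p f + curv X Y Z' p f"
    using assms Z by (simp add: curv_eq VF_add VF_D 1 D_add_right)
next
  fix Z h assume Z: "VF Z" and h: "SF h"
  have 1: "D X (D Y (vf_scale h Z)) p f = X p (\<lambda>q. Y q h) * Z p f + Y p h * D X Z p f
      + (X p h * D Y Z p f + h p * D X (D Y Z) p f)" if "VF X" "VF Y" for X Y
  proof -
    have "D X (D Y (vf_scale h Z)) p = D X (vf_add (vf_scale (\<lambda>q. Y q h) Z) (vf_scale h (D Y Z))) p"
      by (rule D_cong) (use assms(1) that Z h D_scale_right in auto)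
    also have "\<dots> = vf_add (D X (vf_scale (\<lambda>q. Y q h) Z)) (D X (vf_scale h (D Y Z))) p"
      using that Z h by (intro D_add_right assms(1)) (auto intro: SF_VF)
    finally show ?thesis using that assms(1) Z h by (simp add: D_scale_right SF_VF VF_D)
  qed
  \<comment> \<open>Torsion-freeness tested on h: this removes the second derivatives of h that the
    two orders of differentiation leave behind.\<close>
  have 2: "D X Y p h - D Y X p h = X p (\<lambda>q. Y q h) - Y p (\<lambda>q. X q h)"
    using D_torsion[OF assms] lie_apply[OF SF_at[OF h assms(1)], of X Y] by simp
  have "curv X Y (vf_scale h Z) p f
      = h p * curv X Y Z p f + (X p (\<lambda>q. Y q h) - Y p (\<lambda>q. X q h) - (D X Y p h - D Y X p h)) * Z p f"
    using assms Z h by (simp add: curv_eq VF_scale VF_D 1 D_scale_right algebra_simps)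
  then show "curv X Y (vf_scale h Z) p f = h p * curv X Y Z p f"
    by (simp add: 2)
qed

section \<open>The covariant derivative of the curvature and the second Bianchi identity\<close>

lemma D_curv:
  assumes "p \<in> U" "VF V" "VF X" "VF Y" "VF Z"
  shows "D V (curv X Y Z) p f
    = D V (D X (D Y Z)) p f - D V (D Y (D X Z)) p f - D V (D (lie X Y) Z) p f"
  unfolding curvature_def using assms D_diff_right by (simp add: VF_D VF_diff VF_lie)

text \<open>This is (\<nabla>_V R)(X, Y) Z. As a vector field it can be inserted into a slot of a
  tensor when the Ricci identity is differentiated.\<close>

definition cov_curv :: "'a vfield \<Rightarrow> 'a vfield \<Rightarrow> 'a vfield \<Rightarrow> 'a vfield \<Rightarrow> 'a vfield" where
  "cov_curv V X Y Z = vf_diff (vf_diff (vf_diff (D V (curv X Y Z)) (curv (D V X) Y Z))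
     (curv X (D V Y) Z)) (curv X Y (D V Z))"

lemma VF_cov_curv [intro]: "VF V \<Longrightarrow> VF X \<Longrightarrow> VF Y \<Longrightarrow> VF Z \<Longrightarrow> VF (cov_curv V X Y Z)"
  unfolding cov_curv_def by blast

lemma linear_at_jacobi:
  assumes "linear_at p \<Phi>" "p \<in> U" "VF X" "VF Y" "VF Z"
  shows "\<Phi> (lie X (lie Y Z)) + \<Phi> (lie Y (lie Z X)) + \<Phi> (lie Z (lie X Y)) = 0"
proof -
  let ?J = "vf_add (vf_add (lie X (lie Y Z)) (lie Y (lie Z X))) (lie Z (lie X Y))"
  have "\<Phi> ?J = 0"
    by (rule linear_at_zero[OF assms(1,2)]) (simp add: fun_eq_iff jacobi[OF _ assms(3-5)])
  moreover have "\<Phi> ?J = \<Phi> (lie X (lie Y Z)) + \<Phi> (lie Y (lie Z X)) + \<Phi> (lie Z (lie X Y))"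
    using assms by (simp add: linear_at_add[OF assms(1)] VF_add VF_lie)
  ultimately show ?thesis by simp
qed

lemma curv_lie:
  assumes "p \<in> U" "VF V" "VF X" "VF Y" "VF Z"
  shows "curv (D V X) Y Z p f - curv (D X V) Y Z p f
    = D (lie V X) (D Y Z) p f - D Y (D (lie V X) Z) p f + D (lie Y (lie V X)) Z p f"
proof -
  note L = linear_at_curv1[OF assms(1,4,5), of f]
  have "curv (lie V X) Y Z p f = curv (D V X) Y Z p f - curv (D X V) Y Z p f"
    using linear_at_cong[OF L assms(1) VF_lie[OF assms(2,3)] D_torsion[OF _ assms(2,3)]]
      linear_at_diff[OF L VF_D[OF assms(2,3)] VF_D[OF assms(3,2)]] by simp
  moreover have "D (lie (lie V X) Y) Z p f = - D (lie Y (lie V X)) Z p f"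
    using D_lie_left[OF assms(1) VF_lie[OF assms(2,3)] assms(4,5), of f]
      D_lie_left[OF assms(1,4) VF_lie[OF assms(2,3)] assms(5), of f] by simp
  ultimately show ?thesis using curv_apply[of "lie V X" Y Z p f] by linarith
qed

text \<open>In the cyclic sum the third derivatives of Z cancel. Terms like
  \<open>curv (D V X) Y Z\<close> and \<open>curv (D X V) Y Z\<close> pair up to curvatures of
  brackets, which \<open>curv_lie\<close> expands, and the double brackets that remain vanish by
  Jacobi.\<close>

lemma second_bianchi:
  assumes "p \<in> U" "VF V" "VF X" "VF Y" "VF Z"
  shows "cov_curv V X Y Z p f + cov_curv X Y V Z p f + cov_curv Y V X Z p f = 0"
proof -
  have cc: "cov_curv V X Y Z p f = D V (D X (D Y Z)) p f - D V (D Y (D X Z)) p f - D V (D (lie X Y) Z) p f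
      - curv (D V X) Y Z p f + curv (D V Y) X Z p f
      - (D X (D Y (D V Z)) p f - D Y (D X (D V Z)) p f - D (lie X Y) (D V Z) p f)"
    if "VF V" "VF X" "VF Y" for V X Y
    using curv_swap[OF assms(1) that(2) VF_D[OF that(1,3)] assms(5), of f] D_curv[OF assms(1) that assms(5), of f]
      curv_apply[of X Y "D V Z" p f]
    unfolding cov_curv_def vf_diff_apply by linarith
  show ?thesis
    using cc[OF assms(2-4)] cc[OF assms(3,4,2)] cc[OF assms(4,2,3)]
      curv_lie[OF assms(1,2,3,4,5), of f] curv_lie[OF assms(1,3,4,2,5), of f]
      curv_lie[OF assms(1,4,2,3,5), of f] linear_at_jacobi[OF linear_at_D[OF assms(1,5), of f] assms(1-4)]
    by linarith
qed

subsection \<open>The symmetries of the Riemann tensor\<close>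

abbreviation rm :: "'a \<Rightarrow> 'a vfield \<Rightarrow> 'a vfield \<Rightarrow> 'a vfield \<Rightarrow> 'a vfield \<Rightarrow> real" where
  "rm p X Y Z W \<equiv> g p (X p) (curv Z W Y p)"

text \<open>Linearity of the curvature is proved on each test function f. Tangent vectors are
  functions of f, so this is an identity of vectors and can be substituted inside the
  metric.\<close>

lemma linear_at_metric_comp:
  assumes "p \<in> U" "VF Y" "\<And>f. linear_at p (\<lambda>X. F X p f)" "\<And>X. VF X \<Longrightarrow> VF (F X)"
  shows "linear_at p (\<lambda>X. g p (Y p) (F X p))"
proof (rule linear_atI)
  note L = linear_at_metric_right[OF assms(1,2)]
  fix X X' assume X: "VF X" "VF X'"
  have "F (vf_add X X') p = vf_add (F X) (F X') p"
    using linear_at_add[OF assms(3) X] by (simp add: fun_eq_iff)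
  then show "g p (Y p) (F (vf_add X X') p) = g p (Y p) (F X p) + g p (Y p) (F X' p)"
    using linear_at_add[OF L] assms(4) X by simp
next
  note L = linear_at_metric_right[OF assms(1,2)]
  fix h X assume X: "VF X" "SF h"
  have "F (vf_scale h X) p = vf_scale h (F X) p"
    using linear_at_scale[OF assms(3)] X by (simp add: fun_eq_iff)
  then show "g p (Y p) (F (vf_scale h X) p) = h p * g p (Y p) (F X p)"
    using linear_at_scale[OF L] assms(4) X by simp
qed

lemma linear_at_rm2:
  assumes "p \<in> U" "VF X" "VF Z" "VF W" shows "linear_at p (\<lambda>Y. rm p X Y Z W)"
  by (rule linear_at_metric_comp[OF assms(1,2) linear_at_curv3[OF assms(1,3,4)] VF_curv[OF assms(3,4)]])

lemma linear_at_rm3: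
  assumes "p \<in> U" "VF X" "VF Y" "VF W" shows "linear_at p (\<lambda>Z. rm p X Y Z W)"
  by (rule linear_at_metric_comp[OF assms(1,2) linear_at_curv1[OF assms(1,4,3)] VF_curv[OF _ assms(4,3)]])

lemma linear_at_rm4:
  assumes "p \<in> U" "VF X" "VF Y" "VF Z" shows "linear_at p (\<lambda>W. rm p X Y Z W)"
  by (rule linear_at_metric_comp[OF assms(1,2) linear_at_curv2[OF assms(1,4,3)] VF_curv[OF assms(4) _ assms(3)]])

context
  fixes p X Y Z W assumes p: "p \<in> U" and VF: "VF X" "VF Y" "VF Z" "VF W"
begin

lemma rm_swap34: "rm p X Y Z W = - rm p X Y W Z"
proof -
  have "curv Z W Y p = vf_diff (\<lambda>p f. 0) (curv W Z Y) p"
    using curv_swap[OF p VF(3,4,2)] by (simp add: fun_eq_iff)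
  then show ?thesis
    using linear_at_diff[OF linear_at_metric_right[OF p VF(1)] VF_zero, of "curv W Z Y"]
      linear_at_zero[OF linear_at_metric_right[OF p VF(1)] p, of "\<lambda>p f. 0"] VF by auto
qed

lemma rm_bianchi: "rm p X Y Z W + rm p X Z W Y + rm p X W Y Z = 0"
proof -
  let ?B = "vf_add (vf_add (curv Z W Y) (curv W Y Z)) (curv Y Z W)"
  note L = linear_at_metric_right[OF p VF(1)]
  have "g p (X p) (?B p) = 0"
    by (rule linear_at_zero[OF L p]) (use first_bianchi VF in \<open>simp add: fun_eq_iff\<close>)
  then show ?thesis using VF by (simp add: linear_at_add[OF L] VF_add VF_curv)
qed

text \<open>Z W - W Z - [Z, W] annihilates the function g(X, Y). After expansion by metric
  compatibility the products of first derivatives cancel, and g(R(Z, W) X, Y) + g(X, R(Z, W) Y) is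
  what remains.\<close>

lemma rm_swap12: "rm p X Y Z W = - rm p Y X Z W"
proof -
  have d: "Z p (\<lambda>q. W q (\<lambda>r. g r (X r) (Y r)))
      = g p (D Z (D W X) p) (Y p) + g p (D W X p) (D Z Y p)
        + (g p (D Z X p) (D W Y p) + g p (X p) (D Z (D W Y) p))" if "VF Z" "VF W" for Z W
  proof -
    have "Z p (\<lambda>q. W q (\<lambda>r. g r (X r) (Y r)))
        = Z p (\<lambda>q. g q (D W X q) (Y q) + g q (X q) (D W Y q))"
      by (rule VF_apply_cong[OF p that(1)]) (rule D_metric[OF _ that(2) VF(1,2)])
    also have "\<dots> = Z p (\<lambda>q. g q (D W X q) (Y q)) + Z p (\<lambda>q. g q (X q) (D W Y q))"
      by (intro VF_apply_add p SF_metric that VF VF_D)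
    finally show ?thesis
      using D_metric[OF p that(1) VF_D[OF that(2) VF(1)] VF(2)]
        D_metric[OF p that(1) VF(1) VF_D[OF that(2) VF(2)]] by simp
  qed
  have "lie Z W p (\<lambda>r. g r (X r) (Y r))
      = Z p (\<lambda>q. W q (\<lambda>r. g r (X r) (Y r))) - W p (\<lambda>q. Z q (\<lambda>r. g r (X r) (Y r)))"
    by (intro lie_apply SF_at SF_metric p VF)
  moreover have "lie Z W p (\<lambda>r. g r (X r) (Y r)) = g p (D (lie Z W) X p) (Y p) + g p (X p) (D (lie Z W) Y p)"
    by (rule D_metric[OF p VF_lie[OF VF(3,4)] VF(1,2)])
  moreover have "g p (X p) (curv Z W Y p) = g p (X p) (D Z (D W Y) p) - g p (X p) (D W (D Z Y) p) - g p (X p) (D (lie Z W) Y p)"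
    unfolding curvature_def using VF
    by (simp only: linear_at_diff[OF linear_at_metric_right[OF p VF(1)]] VF_diff VF_D VF_lie)
  moreover have "g p (curv Z W X p) (Y p) = g p (D Z (D W X) p) (Y p) - g p (D W (D Z X) p) (Y p) - g p (D (lie Z W) X p) (Y p)"
    unfolding curvature_def using VF
    by (simp only: linear_at_diff[OF linear_at_metric_left[OF p VF(2)]] VF_diff VF_D VF_lie)
  moreover have "g p (Y p) (curv Z W X p) = g p (curv Z W X p) (Y p)"
    by (rule metric_sym[OF p VF(2) VF_curv[OF VF(3,4,1)]])
  ultimately show ?thesis using d[OF VF(3,4)] d[OF VF(4,3)] by linarith
qed

end

text \<open>The classical combination of four first Bianchi identities with the antisymmetries in
  both pairs.\<close>

lemma rm_pair_sym:
  assumes "p \<in> U" "VF X" "VF Y" "VF Z" "VF W"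
  shows "rm p X Y Z W = rm p Z W X Y"
  using rm_bianchi[OF assms(1,2,3,4,5)] rm_bianchi[OF assms(1,3,4,5,2)] rm_bianchi[OF assms(1,4,5,2,3)]
    rm_bianchi[OF assms(1,5,2,3,4)] rm_swap34[OF assms(1,2,4,5,3)] rm_swap34[OF assms(1,3,4,5,2)]
    rm_swap34[OF assms(1,3,5,4,2)] rm_swap12[OF assms(1,3,2,4,5)] rm_swap12[OF assms(1,4,2,3,5)]
    rm_swap12[OF assms(1,4,3,5,2)] rm_swap12[OF assms(1,5,2,3,4)] rm_swap12[OF assms(1,5,3,4,2)]
    rm_swap12[OF assms(1,5,4,2,3)]
  by linarith

end

section \<open>Tensors and the Ricci identity\<close>

lemma cov_deriv_apply:
  "cov_deriv D T (Xs @ [X]) p = X p (T Xs) - (\<Sum>m<length Xs. T (Xs[m := D X (Xs ! m)]) p)"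
  by (simp add: cov_deriv_def Let_def)

text \<open>For the second derivative the first direction X is an ordinary argument; hence the
  correction by \<open>D Y X\<close>.\<close>

lemma cov_deriv_cov_deriv_apply:
  "cov_deriv D (cov_deriv D T) (Xs @ [X, Y]) p
    = Y p (cov_deriv D T (Xs @ [X])) - (\<Sum>m<length Xs. cov_deriv D T (Xs[m := D Y (Xs ! m)] @ [X]) p)
      - cov_deriv D T (Xs @ [D Y X]) p"
  using cov_deriv_apply[of D "cov_deriv D T" "Xs @ [X]" Y p]
  by (simp add: list_update_append nth_append)

lemma cov_deriv3_apply:
  "cov_deriv D (cov_deriv D (cov_deriv D T)) (Xs @ [X, Y, Z]) p
    = Z p (cov_deriv D (cov_deriv D T) (Xs @ [X, Y]))
      - (\<Sum>m<length Xs. cov_deriv D (cov_deriv D T) (Xs[m := D Z (Xs ! m)] @ [X, Y]) p)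
      - cov_deriv D (cov_deriv D T) (Xs @ [D Z X, Y]) p - cov_deriv D (cov_deriv D T) (Xs @ [X, D Z Y]) p"
  using cov_deriv_apply[of D "cov_deriv D (cov_deriv D T)" "Xs @ [X, Y]" Z p]
  by (simp add: list_update_append nth_append)

lemma sum_off_diagonal_swap:
  fixes r :: nat and F :: "nat \<Rightarrow> nat \<Rightarrow> 'b::comm_monoid_add"
  shows "(\<Sum>m<r. \<Sum>l\<in>{..<r} - {m}. F m l) = (\<Sum>m<r. \<Sum>l\<in>{..<r} - {m}. F l m)"
proof -
  have *: "(\<Sum>m<r. \<Sum>l\<in>{..<r} - {m}. F m l) = (\<Sum>m<r. \<Sum>l<r. if l = m then 0 else F m l)"
    for F :: "nat \<Rightarrow> nat \<Rightarrow> 'b"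
    by (intro sum.cong refl sum.mono_neutral_cong_left) auto
  show ?thesis
    unfolding * by (subst sum.swap) (intro sum.cong refl, auto)
qed

text \<open>Once slot m holds Z, the summand l = m applies \<phi> to Z itself while the others alter
  two distinct slots. This separates pure second derivatives of one slot from mixed terms.\<close>

lemma sum_split_update:
  fixes F :: "'b list \<Rightarrow> 'c::comm_monoid_add"
  assumes "m < length Xs"
  shows "(\<Sum>l<length Xs. F (Xs[m := Z, l := \<phi> (Xs[m := Z] ! l)]))
    = F (Xs[m := \<phi> Z]) + (\<Sum>l\<in>{..<length Xs} - {m}. F (Xs[m := Z, l := \<phi> (Xs ! l)]))"
  using assms by (subst sum.remove[of _ m]) (auto intro!: arg_cong2[of _ _ _ _ "(+)"] sum.cong)

context levi_civita_on
begin

text \<open>\<open>cov_deriv\<close> and \<open>component\<close> accept any function of lists of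
  fields; this singles out those that a frame on U can expand slot by slot.\<close>

definition tensor_on :: "nat \<Rightarrow> 'a tensor \<Rightarrow> bool" where
  "tensor_on r T \<longleftrightarrow> (\<forall>Xs. length Xs = r \<longrightarrow> list_all VF Xs \<longrightarrow>
     SF (T Xs) \<and> (\<forall>p\<in>U. \<forall>m<r. linear_at p (\<lambda>X. T (Xs[m := X]) p)))"

lemma tensor_onI:
  assumes "\<And>Xs. length Xs = r \<Longrightarrow> list_all VF Xs \<Longrightarrow> SF (T Xs)"
    and "\<And>Xs p m. length Xs = r \<Longrightarrow> list_all VF Xs \<Longrightarrow> p \<in> U \<Longrightarrow> m < r
      \<Longrightarrow> linear_at p (\<lambda>X. T (Xs[m := X]) p)"
  shows "tensor_on r T"
  using assms unfolding tensor_on_def by blast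

lemma SF_tensor: "tensor_on r T \<Longrightarrow> length Xs = r \<Longrightarrow> list_all VF Xs \<Longrightarrow> SF (T Xs)"
  unfolding tensor_on_def by blast

lemma linear_at_tensor:
  "tensor_on r T \<Longrightarrow> length Xs = r \<Longrightarrow> list_all VF Xs \<Longrightarrow> p \<in> U \<Longrightarrow> m < r
    \<Longrightarrow> linear_at p (\<lambda>X. T (Xs[m := X]) p)"
  unfolding tensor_on_def by blast

lemma VF_update:
  assumes "list_all VF Xs" "VF X"
  shows "list_all VF (Xs[m := X])"
  unfolding list_all_iff
proof
  fix Y assume "Y \<in> set (Xs[m := X])"
  then have "Y = X \<or> Y \<in> set Xs" using set_update_subset_insert by fastforce
  then show "VF Y" using assms by (auto simp: list_all_iff)
qed

lemma VF_nth: "list_all VF Xs \<Longrightarrow> m < length Xs \<Longrightarrow> VF (Xs ! m)"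
  by (simp add: list_all_length)

lemma SF_cov_deriv:
  assumes "tensor_on r T" "length Xs = r" "list_all VF Xs" "VF X"
  shows "SF (cov_deriv D T (Xs @ [X]))"
proof -
  have "SF (T (Xs[m := D X (Xs ! m)]))" if "m < length Xs" for m
    using that assms by (intro SF_tensor[OF assms(1)] VF_update VF_D VF_nth) auto
  then have "SF (\<lambda>p. X p (T Xs) - (\<Sum>m<length Xs. T (Xs[m := D X (Xs ! m)]) p))"
    by (intro SF_diff[OF SF_VF[OF assms(4) SF_tensor[OF assms(1-3)]] SF_sum]) simp
  then show ?thesis by (simp add: cov_deriv_apply[abs_def])
qed

lemma linear_at_cov_deriv_last:
  assumes "tensor_on r T" "length Xs = r" "list_all VF Xs" "p \<in> U"
  shows "linear_at p (\<lambda>X. cov_deriv D T (Xs @ [X]) p)"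
  unfolding cov_deriv_apply
proof (intro linear_at_minus linear_at_sum)
  show "linear_at p (\<lambda>X. X p (T Xs))" by (rule linear_atI) simp_all
  fix m assume "m \<in> {..<length Xs}"
  then have m: "m < r" "VF (Xs ! m)" using assms VF_nth by auto
  note L = linear_at_tensor[OF assms m(1)]
  show "linear_at p (\<lambda>X. T (Xs[m := D X (Xs ! m)]) p)"
  proof (rule linear_atI)
    fix X Y assume X: "VF X" "VF Y"
    have "T (Xs[m := D (vf_add X Y) (Xs ! m)]) p = T (Xs[m := vf_add (D X (Xs ! m)) (D Y (Xs ! m))]) p"
      by (rule linear_at_cong[OF L assms(4) VF_D[OF VF_add[OF X] m(2)]])
        (rule connection_props(2)[OF X m(2) SF_const])
    then show "T (Xs[m := D (vf_add X Y) (Xs ! m)]) p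
        = T (Xs[m := D X (Xs ! m)]) p + T (Xs[m := D Y (Xs ! m)]) p"
      using linear_at_add[OF L VF_D[OF X(1) m(2)] VF_D[OF X(2) m(2)]] by simp
  next
    fix h X assume X: "SF h" "VF X"
    have "T (Xs[m := D (vf_scale h X) (Xs ! m)]) p = T (Xs[m := vf_scale h (D X (Xs ! m))]) p"
      by (rule linear_at_cong[OF L assms(4) VF_D[OF VF_scale[OF X] m(2)]])
        (rule connection_props(3)[OF X(2) m(2) m(2) X(1)])
    then show "T (Xs[m := D (vf_scale h X) (Xs ! m)]) p = h p * T (Xs[m := D X (Xs ! m)]) p"
      using linear_at_scale[OF L X(1) VF_D[OF X(2) m(2)]] by simp
  qed
qed

text \<open>Neither the X-derivative of \<open>T (Xs[m := Z])\<close> nor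
  \<open>T (Xs[m := D X Z])\<close> is function-linear in Z: scaling by h adds the same term with
  X(h) to both, and it cancels in the difference.\<close>

lemma linear_at_cov_deriv_slot:
  assumes T: "tensor_on r T" and Xs: "length Xs = r" "list_all VF Xs" and X: "VF X" and p: "p \<in> U"
    and m: "m < r"
  shows "linear_at p (\<lambda>Z. cov_deriv D T (Xs[m := Z] @ [X]) p)"
proof -
  note L = linear_at_tensor[OF T Xs _ m]
  have "linear_at p (\<lambda>Z. (X p (T (Xs[m := Z])) - T (Xs[m := D X Z]) p)
      - (\<Sum>l\<in>{..<length Xs} - {m}. T (Xs[l := D X (Xs ! l), m := Z]) p))"
  proof (rule linear_at_minus[OF _ linear_at_sum])
    fix l assume "l \<in> {..<length Xs} - {m}"
    then show "linear_at p (\<lambda>Z. T (Xs[l := D X (Xs ! l), m := Z]) p)"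
      using Xs X m p by (intro linear_at_tensor[OF T] VF_update VF_D VF_nth) auto
  next
    show "linear_at p (\<lambda>Z. X p (T (Xs[m := Z])) - T (Xs[m := D X Z]) p)"
    proof (rule linear_atI)
      fix Z Z' assume Z: "VF Z" "VF Z'"
      have S: "SF (T (Xs[m := Z]))" "SF (T (Xs[m := Z']))"
        using Xs Z by (simp_all add: SF_tensor[OF T] VF_update)
      have "X p (T (Xs[m := vf_add Z Z'])) = X p (\<lambda>q. T (Xs[m := Z]) q + T (Xs[m := Z']) q)"
        by (rule VF_apply_cong[OF p X]) (rule linear_at_add[OF L Z])
      moreover have "T (Xs[m := D X (vf_add Z Z')]) p = T (Xs[m := vf_add (D X Z) (D X Z')]) p"
        by (rule linear_at_cong[OF L p VF_D[OF X VF_add[OF Z]]]) (use p in \<open>simp_all add: D_add_right[OF _ X Z]\<close>)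
      ultimately show "X p (T (Xs[m := vf_add Z Z'])) - T (Xs[m := D X (vf_add Z Z')]) p
        = X p (T (Xs[m := Z])) - T (Xs[m := D X Z]) p + (X p (T (Xs[m := Z'])) - T (Xs[m := D X Z']) p)"
        using VF_apply_add[OF p X S] linear_at_add[OF L[OF p] VF_D[OF X Z(1)] VF_D[OF X Z(2)]] by simp
    next
      fix h Z assume Z: "SF h" "VF Z"
      have S: "SF (T (Xs[m := Z]))" using Xs Z by (simp add: SF_tensor[OF T] VF_update)
      have "X p (T (Xs[m := vf_scale h Z])) = X p (\<lambda>q. h q * T (Xs[m := Z]) q)"
        by (rule VF_apply_cong[OF p X]) (rule linear_at_scale[OF L Z])
      moreover have "T (Xs[m := D X (vf_scale h Z)]) p
          = T (Xs[m := vf_add (vf_scale (\<lambda>q. X q h) Z) (vf_scale h (D X Z))]) p"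
        by (rule linear_at_cong[OF L p VF_D[OF X VF_scale[OF Z]]])
          (use p in \<open>simp_all add: D_scale_right[OF _ X Z]\<close>)
      ultimately show "X p (T (Xs[m := vf_scale h Z])) - T (Xs[m := D X (vf_scale h Z)]) p
        = h p * (X p (T (Xs[m := Z])) - T (Xs[m := D X Z]) p)"
        using VF_apply_mult[OF p X Z(1) S] linear_at_scale[OF L[OF p] Z(1) VF_D[OF X Z(2)]]
          linear_at_scale[OF L[OF p] SF_VF[OF X Z(1)] Z(2)]
          linear_at_add[OF L[OF p] VF_scale[OF SF_VF[OF X Z(1)] Z(2)] VF_scale[OF Z(1) VF_D[OF X Z(2)]]]
        by (simp add: algebra_simps)
    qed
  qed
  moreover have "cov_deriv D T (Xs[m := Z] @ [X]) p = (X p (T (Xs[m := Z])) - T (Xs[m := D X Z]) p)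
      - (\<Sum>l\<in>{..<length Xs} - {m}. T (Xs[l := D X (Xs ! l), m := Z]) p)" for Z
  proof -
    have "(\<Sum>l\<in>{..<length Xs} - {m}. T (Xs[m := Z, l := D X (Xs ! l)]) p)
        = (\<Sum>l\<in>{..<length Xs} - {m}. T (Xs[l := D X (Xs ! l), m := Z]) p)"
      by (rule sum.cong) (auto simp: list_update_swap)
    then show ?thesis
      using sum_split_update[of m Xs "\<lambda>L. T L p" Z "D X"] m Xs(1) by (simp add: cov_deriv_apply)
  qed
  ultimately show ?thesis by simp
qed

lemma tensor_on_cov_deriv:
  assumes "tensor_on r T"
  shows "tensor_on (Suc r) (cov_deriv D T)"
proof (rule tensor_onI)
  fix Ys :: "'a vfield list" assume Ys: "length Ys = Suc r" "list_all VF Ys"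
  then obtain Xs X where eq: "Ys = Xs @ [X]" by (metis length_0_conv nat.distinct(1) rev_exhaust)
  then have X: "length Xs = r" "list_all VF Xs" "VF X" using Ys by auto
  show "SF (cov_deriv D T Ys)" unfolding eq by (rule SF_cov_deriv[OF assms X])
  fix p m assume p: "p \<in> U" and m: "m < Suc r"
  show "linear_at p (\<lambda>Z. cov_deriv D T (Ys[m := Z]) p)"
  proof (cases "m = r")
    case True
    then show ?thesis using linear_at_cov_deriv_last[OF assms X(1,2) p] X(1) by (simp add: eq list_update_append)
  next
    case False
    then show ?thesis
      using linear_at_cov_deriv_slot[OF assms X p, of m] m X(1) by (simp add: eq list_update_append)
  qed
qed

context
  fixes r T Xs X Y p
  assumes T: "tensor_on r T" and Xs: "length Xs = r" "list_all VF Xs" and X: "VF X" and Y: "VF Y"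
    and p: "p \<in> U"
begin

text \<open>The direction listed last is differentiated last, so the left side is the commutator in
  the order Y, X. This order gives one minus sign, the action on arguments instead of on T another,
  and \<open>curv X Y\<close> appears with a plus.\<close>

lemma ricci_identity:
  "cov_deriv D (cov_deriv D T) (Xs @ [X, Y]) p - cov_deriv D (cov_deriv D T) (Xs @ [Y, X]) p
    = (\<Sum>m<r. T (Xs[m := curv X Y (Xs ! m)]) p)"
proof -
  have VFm: "VF (Xs ! m)" if "m < r" for m using that Xs VF_nth by blast
  have Y1: "Y p (cov_deriv D T (Xs @ [X])) = Y p (\<lambda>q. X q (T Xs)) - (\<Sum>m<r. Y p (T (Xs[m := D X (Xs ! m)])))"
    if X: "VF X" and Y: "VF Y" for X Y
  proof -
    have S: "SF (T (Xs[m := D X (Xs ! m)]))" if "m < r" for m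
      using that Xs X VFm by (intro SF_tensor[OF T] VF_update VF_D) auto
    have "Y p (cov_deriv D T (Xs @ [X])) = Y p (\<lambda>q. X q (T Xs) - (\<Sum>m<r. T (Xs[m := D X (Xs ! m)]) q))"
      by (simp add: cov_deriv_apply[abs_def] Xs(1))
    also have "\<dots> = Y p (\<lambda>q. X q (T Xs)) - Y p (\<lambda>q. \<Sum>m<r. T (Xs[m := D X (Xs ! m)]) q)"
      by (rule VF_apply_diff[OF p Y SF_VF[OF X SF_tensor[OF T Xs]] SF_sum]) (use S in simp)
    also have "Y p (\<lambda>q. \<Sum>m<r. T (Xs[m := D X (Xs ! m)]) q) = (\<Sum>m<r. Y p (T (Xs[m := D X (Xs ! m)])))"
      by (rule VF_apply_sum[OF p Y]) (use S in simp)
    finally show ?thesis .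
  qed
  \<comment> \<open>Terms that differentiate two different slots, one along each direction; being
    symmetric in X and Y they drop out of the commutator.\<close>
  define Q where "Q X Y = (\<Sum>m<r. \<Sum>l\<in>{..<r} - {m}. T (Xs[m := D Y (Xs ! m), l := D X (Xs ! l)]) p)" for X Y
  have Q: "Q X Y = Q Y X"
    unfolding Q_def
    by (subst sum_off_diagonal_swap) (intro sum.cong refl arg_cong[of _ _ "\<lambda>L. T L p"], auto simp: list_update_swap)
  have Y2: "(\<Sum>m<r. cov_deriv D T (Xs[m := D Y (Xs ! m)] @ [X]) p)
     = (\<Sum>m<r. X p (T (Xs[m := D Y (Xs ! m)]))) - (\<Sum>m<r. T (Xs[m := D X (D Y (Xs ! m))]) p) - Q X Y" for X Y
  proof -
    have "cov_deriv D T (Xs[m := D Y (Xs ! m)] @ [X]) p = X p (T (Xs[m := D Y (Xs ! m)]))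
      - T (Xs[m := D X (D Y (Xs ! m))]) p
      - (\<Sum>l\<in>{..<r} - {m}. T (Xs[m := D Y (Xs ! m), l := D X (Xs ! l)]) p)" if "m < r" for m
      using sum_split_update[of m Xs "\<lambda>L. T L p" "D Y (Xs ! m)" "D X"] that Xs(1)
      by (simp add: cov_deriv_apply)
    then show ?thesis by (simp add: Q_def sum_subtractf)
  qed
  have main: "cov_deriv D (cov_deriv D T) (Xs @ [X, Y]) p
      = Y p (\<lambda>q. X q (T Xs)) - (\<Sum>m<r. Y p (T (Xs[m := D X (Xs ! m)])))
      - ((\<Sum>m<r. X p (T (Xs[m := D Y (Xs ! m)]))) - (\<Sum>m<r. T (Xs[m := D X (D Y (Xs ! m))]) p) - Q X Y)
      - (D Y X p (T Xs) - (\<Sum>m<r. T (Xs[m := D (D Y X) (Xs ! m)]) p))" if "VF X" "VF Y" for X Y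
    unfolding cov_deriv_cov_deriv_apply Y1[OF that] Xs(1) Y2 by (simp add: cov_deriv_apply Xs(1))
  have c: "T (Xs[m := curv X Y (Xs ! m)]) p = T (Xs[m := D X (D Y (Xs ! m))]) p - T (Xs[m := D Y (D X (Xs ! m))]) p
      - (T (Xs[m := D (D X Y) (Xs ! m)]) p - T (Xs[m := D (D Y X) (Xs ! m)]) p)" if m: "m < r" for m
  proof -
    note L = linear_at_tensor[OF T Xs p m] and V = VFm[OF m]
    have "T (Xs[m := D (lie X Y) (Xs ! m)]) p = T (Xs[m := vf_diff (D (D X Y) (Xs ! m)) (D (D Y X) (Xs ! m))]) p"
      by (rule linear_at_cong[OF L p VF_D[OF VF_lie[OF X Y] V]]) (simp add: fun_eq_iff D_lie_left[OF _ X Y V])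
    also have "\<dots> = T (Xs[m := D (D X Y) (Xs ! m)]) p - T (Xs[m := D (D Y X) (Xs ! m)]) p"
      by (rule linear_at_diff[OF L VF_D[OF VF_D[OF X Y] V] VF_D[OF VF_D[OF Y X] V]])
    finally show ?thesis
      unfolding curvature_def
      using linear_at_diff[OF L VF_diff[OF VF_D[OF X VF_D[OF Y V]] VF_D[OF Y VF_D[OF X V]]] VF_D[OF VF_lie[OF X Y] V]]
        linear_at_diff[OF L VF_D[OF X VF_D[OF Y V]] VF_D[OF Y VF_D[OF X V]]] by simp
  qed
  \<comment> \<open>The commutator acting on the scalar \<open>T Xs\<close> is a bracket, which the
    corrections by \<open>D X Y\<close> and \<open>D Y X\<close> absorb.\<close>
  have "X p (\<lambda>q. Y q (T Xs)) - Y p (\<lambda>q. X q (T Xs)) = D X Y p (T Xs) - D Y X p (T Xs)"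
    using lie_apply[OF SF_at[OF SF_tensor[OF T Xs] p], of X Y] D_torsion[OF p X Y] by simp
  then show ?thesis
    unfolding main[OF X Y] main[OF Y X] Q using c by (simp add: sum_subtractf)
qed

end

text \<open>The Ricci identity is differentiated along V with arbitrary fields. Each correction of
  an argument by \<open>D V\<close> is again a Ricci identity with one field replaced, and together
  they complete the derivative of the curvature field to \<open>cov_curv\<close>.\<close>

lemma cov_deriv_ricci_identity:
  assumes T: "tensor_on r T" and Xs: "length Xs = r" "list_all VF Xs" and X: "VF X" and Y: "VF Y"
    and V: "VF V" and p: "p \<in> U"
  shows "cov_deriv D (cov_deriv D (cov_deriv D T)) (Xs @ [X, Y, V]) p
    - cov_deriv D (cov_deriv D (cov_deriv D T)) (Xs @ [Y, X, V]) p
    = (\<Sum>m<r. cov_deriv D T (Xs[m := curv X Y (Xs ! m)] @ [V]) p + T (Xs[m := cov_curv V X Y (Xs ! m)]) p)"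
proof -
  let ?T2 = "cov_deriv D (cov_deriv D T)"
  define K where "K m = curv X Y (Xs ! m)" for m
  have VFm: "VF (Xs ! m)" if "m < r" for m using that Xs VF_nth by blast
  have K: "VF (K m)" if "m < r" for m unfolding K_def by (rule VF_curv[OF X Y VFm[OF that]])
  note R = ricci_identity[OF T]
  have S: "SF (?T2 (Xs @ [X, Y]))" if "VF X" "VF Y" for X Y
    by (rule SF_tensor[OF tensor_on_cov_deriv[OF tensor_on_cov_deriv[OF T]]]) (use Xs that in auto)
  have "V p (?T2 (Xs @ [X, Y])) - V p (?T2 (Xs @ [Y, X])) = V p (\<lambda>q. ?T2 (Xs @ [X, Y]) q - ?T2 (Xs @ [Y, X]) q)"
    by (rule VF_apply_diff[OF p V S[OF X Y] S[OF Y X], symmetric])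
  also have "\<dots> = V p (\<lambda>q. \<Sum>m<r. T (Xs[m := K m]) q)"
    unfolding K_def by (rule VF_apply_cong[OF p V]) (rule R[OF Xs X Y])
  also have "\<dots> = (\<Sum>m<r. V p (T (Xs[m := K m])))"
    using K Xs by (intro VF_apply_sum[OF p V] SF_tensor[OF T] VF_update) auto
  also have "\<dots> = (\<Sum>m<r. cov_deriv D T (Xs[m := K m] @ [V]) p + T (Xs[m := D V (K m)]) p
      + (\<Sum>l\<in>{..<r} - {m}. T (Xs[m := K m, l := D V (Xs ! l)]) p))"
  proof (rule sum.cong[OF refl])
    fix m assume "m \<in> {..<r}"
    then show "V p (T (Xs[m := K m])) = cov_deriv D T (Xs[m := K m] @ [V]) p + T (Xs[m := D V (K m)]) p
        + (\<Sum>l\<in>{..<r} - {m}. T (Xs[m := K m, l := D V (Xs ! l)]) p)"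
      using sum_split_update[of m Xs "\<lambda>L. T L p" "K m" "D V"] Xs(1) by (simp add: cov_deriv_apply)
  qed
  finally have 1: "V p (?T2 (Xs @ [X, Y])) - V p (?T2 (Xs @ [Y, X]))
      = (\<Sum>m<r. cov_deriv D T (Xs[m := K m] @ [V]) p) + (\<Sum>m<r. T (Xs[m := D V (K m)]) p)
      + (\<Sum>m<r. \<Sum>l\<in>{..<r} - {m}. T (Xs[m := K m, l := D V (Xs ! l)]) p)"
    by (simp add: sum.distrib)
  have "(\<Sum>m<r. ?T2 (Xs[m := D V (Xs ! m)] @ [X, Y]) p) - (\<Sum>m<r. ?T2 (Xs[m := D V (Xs ! m)] @ [Y, X]) p)
      = (\<Sum>m<r. ?T2 (Xs[m := D V (Xs ! m)] @ [X, Y]) p - ?T2 (Xs[m := D V (Xs ! m)] @ [Y, X]) p)"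
    by (simp add: sum_subtractf)
  also have "\<dots> = (\<Sum>m<r. T (Xs[m := curv X Y (D V (Xs ! m))]) p
      + (\<Sum>l\<in>{..<r} - {m}. T (Xs[m := D V (Xs ! m), l := K l]) p))"
  proof (rule sum.cong[OF refl])
    fix m assume "m \<in> {..<r}"
    then have m: "m < r" by simp
    have "?T2 (Xs[m := D V (Xs ! m)] @ [X, Y]) p - ?T2 (Xs[m := D V (Xs ! m)] @ [Y, X]) p
      = (\<Sum>l<r. T (Xs[m := D V (Xs ! m), l := curv X Y (Xs[m := D V (Xs ! m)] ! l)]) p)"
      by (rule R[OF _ VF_update[OF Xs(2) VF_D[OF V VFm[OF m]]] X Y p]) (simp add: Xs(1))
    then show "?T2 (Xs[m := D V (Xs ! m)] @ [X, Y]) p - ?T2 (Xs[m := D V (Xs ! m)] @ [Y, X]) p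
      = T (Xs[m := curv X Y (D V (Xs ! m))]) p + (\<Sum>l\<in>{..<r} - {m}. T (Xs[m := D V (Xs ! m), l := K l]) p)"
      using sum_split_update[of m Xs "\<lambda>L. T L p" "D V (Xs ! m)" "curv X Y"] Xs(1) m by (simp add: K_def)
  qed
  finally have 2: "(\<Sum>m<r. ?T2 (Xs[m := D V (Xs ! m)] @ [X, Y]) p) - (\<Sum>m<r. ?T2 (Xs[m := D V (Xs ! m)] @ [Y, X]) p)
      = (\<Sum>m<r. T (Xs[m := curv X Y (D V (Xs ! m))]) p)
      + (\<Sum>m<r. \<Sum>l\<in>{..<r} - {m}. T (Xs[m := D V (Xs ! m), l := K l]) p)"
    by (simp add: sum.distrib)
  \<comment> \<open>The mixed terms of the two sides differ only in which slot carries the curvature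
    and which the derivative.\<close>
  have 3: "(\<Sum>m<r. \<Sum>l\<in>{..<r} - {m}. T (Xs[m := D V (Xs ! m), l := K l]) p)
      = (\<Sum>m<r. \<Sum>l\<in>{..<r} - {m}. T (Xs[m := K m, l := D V (Xs ! l)]) p)"
    by (subst sum_off_diagonal_swap)
      (intro sum.cong refl arg_cong[of _ _ "\<lambda>L. T L p"], auto simp: list_update_swap)
  have 4: "?T2 (Xs @ [D V X, Y]) p - ?T2 (Xs @ [Y, D V X]) p = (\<Sum>m<r. T (Xs[m := curv (D V X) Y (Xs ! m)]) p)"
    by (rule R[OF Xs VF_D[OF V X] Y p])
  have 5: "?T2 (Xs @ [X, D V Y]) p - ?T2 (Xs @ [D V Y, X]) p = (\<Sum>m<r. T (Xs[m := curv X (D V Y) (Xs ! m)]) p)"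
    by (rule R[OF Xs X VF_D[OF V Y] p])
  have 6: "T (Xs[m := cov_curv V X Y (Xs ! m)]) p = T (Xs[m := D V (K m)]) p - T (Xs[m := curv (D V X) Y (Xs ! m)]) p
      - T (Xs[m := curv X (D V Y) (Xs ! m)]) p - T (Xs[m := curv X Y (D V (Xs ! m))]) p" if m: "m < r" for m
  proof -
    note L = linear_at_tensor[OF T Xs p m] and W = VFm[OF m]
    note a = VF_D[OF V K[OF m]] VF_curv[OF VF_D[OF V X] Y W] VF_curv[OF X VF_D[OF V Y] W]
      VF_curv[OF X Y VF_D[OF V W]]
    show ?thesis
      unfolding cov_curv_def K_def[symmetric]
      using linear_at_diff[OF L VF_diff[OF VF_diff[OF a(1,2)] a(3)] a(4)]
        linear_at_diff[OF L VF_diff[OF a(1,2)] a(3)] linear_at_diff[OF L a(1,2)] by simp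
  qed
  have 7: "(\<Sum>m<r. T (Xs[m := cov_curv V X Y (Xs ! m)]) p) = (\<Sum>m<r. T (Xs[m := D V (K m)]) p)
      - (\<Sum>m<r. T (Xs[m := curv (D V X) Y (Xs ! m)]) p) - (\<Sum>m<r. T (Xs[m := curv X (D V Y) (Xs ! m)]) p)
      - (\<Sum>m<r. T (Xs[m := curv X Y (D V (Xs ! m))]) p)"
    using 6 by (simp add: sum_subtractf)
  show ?thesis
    unfolding cov_deriv3_apply Xs(1) sum.distrib K_def[symmetric] 7
    using 1 2 3 4 5 by linarith
qed

end

section \<open>Orthonormal frames and Einstein metrics\<close>

lemma sum_lists_snoc:
  fixes F :: "'n::finite list \<Rightarrow> 'b::comm_monoid_add"
  shows "(\<Sum>I\<in>{I. length I = Suc n}. F I) = (\<Sum>I\<in>{I. length I = n}. \<Sum>i\<in>UNIV. F (I @ [i]))"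
  unfolding sum.cartesian_product
proof (rule sum.reindex_bij_witness[of _ "\<lambda>(I, i). I @ [i]" "\<lambda>I. (butlast I, last I)"])
  fix I :: "'n list" assume "I \<in> {I. length I = Suc n}"
  then have "I \<noteq> []" by auto
  then show "(case (butlast I, last I) of (I, i) \<Rightarrow> I @ [i]) = I"
    and "(\<lambda>(I, i). F (I @ [i])) (butlast I, last I) = F I" by simp_all
  show "(butlast I, last I) \<in> {I. length I = n} \<times> UNIV" using \<open>I \<in> _\<close> by simp
qed auto

lemma sum_lists_Cons:
  fixes F :: "'n::finite list \<Rightarrow> 'b::comm_monoid_add"
  shows "(\<Sum>I\<in>{I. length I = Suc n}. F I) = (\<Sum>i\<in>UNIV. \<Sum>I\<in>{I. length I = n}. F (i # I))"
  unfolding sum.cartesian_product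
  by (rule sum.reindex_bij_witness[of _ "\<lambda>(i, I). i # I" "\<lambda>I. (hd I, tl I)"])
    (auto simp: length_Suc_conv)

text \<open>Exchanging the entry in slot m with the contracted index q is an involution; it moves a
  correction from one factor of an inner product to the other.\<close>

lemma sum_lists_slot_swap:
  fixes F :: "'n::finite list \<Rightarrow> 'n \<Rightarrow> 'b::comm_monoid_add"
  assumes "m < n"
  shows "(\<Sum>I\<in>{I. length I = n}. \<Sum>q\<in>UNIV. F I q)
    = (\<Sum>I\<in>{I. length I = n}. \<Sum>q\<in>UNIV. F (I[m := q]) (I ! m))"
  unfolding sum.cartesian_product
  by (rule sum.reindex_bij_witness[of _ "\<lambda>(I, q). (I[m := q], I ! m)" "\<lambda>(I, q). (I[m := q], I ! m)"])
    (use assms in auto)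

locale framed = levi_civita_on A g D U
  for A :: "('a::{t2_space, second_countable_topology}, 'n::finite) chart set"
    and g :: "'a metric" and D :: "'a connection" and U :: "'a set" +
  fixes e :: "'n \<Rightarrow> 'a vfield"
  assumes frame: "orthonormal_frame_on A g U e"
begin

lemma VF_e: "VF (e i)"
  using frame unfolding orthonormal_frame_on_def by blast

lemma VF_map_e: "list_all VF (map e I)"
  by (simp add: list_all_iff VF_e)

lemma g_e: "p \<in> U \<Longrightarrow> g p (e i p) (e j p) = (if i = j then 1 else 0)"
  using frame unfolding orthonormal_frame_on_def by blast

lemma frame_expansion:
  assumes p: "p \<in> U" and X: "VF X"
  shows "X p = (\<lambda>f. \<Sum>i\<in>UNIV. g p (X p) (e i p) * e i p f)"
  by (rule tangent_space_basis[of p "g p" "\<lambda>i. e i p" "X p"])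
    (auto intro!: metric_lincomb VF_tangent VF_e p X simp: g_e[OF p])

text \<open>On U the field X is a combination of the frame fields with coefficients smooth on U, so
  function-linearity applies without extending anything.\<close>

lemma linear_at_frame:
  assumes L: "linear_at p \<Phi>" and p: "p \<in> U" and X: "VF X"
  shows "\<Phi> X = (\<Sum>i\<in>UNIV. g p (X p) (e i p) * \<Phi> (e i))"
proof -
  define h where "h i q = g q (X q) (e i q)" for i q
  have h: "SF (h i)" for i unfolding h_def by (rule SF_metric[OF X VF_e])
  \<comment> \<open>Partial sums, since \<open>linear_at\<close> handles two summands at a
    time.\<close>
  define S where "S I = (\<lambda>q f. \<Sum>i\<in>I. h i q * e i q f)" for I
  have S: "VF (S I) \<and> \<Phi> (S I) = (\<Sum>i\<in>I. h i p * \<Phi> (e i))" if "finite I" for I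
    using that
  proof (induction I rule: finite_induct)
    case empty
    have "\<Phi> (\<lambda>q f. 0) = 0" by (rule linear_at_zero[OF L p]) simp
    then show ?case using VF_zero by (simp add: S_def)
  next
    case (insert i I)
    have eq: "S (insert i I) = vf_add (vf_scale (h i) (e i)) (S I)"
      using insert by (simp add: S_def vf_add_def vf_scale_def fun_eq_iff)
    have SI: "VF (S I)" using insert by blast
    have "\<Phi> (S (insert i I)) = h i p * \<Phi> (e i) + \<Phi> (S I)"
      unfolding eq linear_at_add[OF L VF_scale[OF h VF_e] SI] linear_at_scale[OF L h VF_e] ..
    moreover have "VF (S (insert i I))"
      unfolding eq by (rule VF_add[OF VF_scale[OF h VF_e] SI])
    ultimately show ?case using insert by simp
  qed
  have "\<Phi> X = \<Phi> (S UNIV)"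
    by (rule linear_at_cong[OF L p X]) (simp add: S_def h_def frame_expansion[OF _ X, symmetric])
  then show ?thesis using S[of UNIV] by (simp add: h_def)
qed

lemma connection_form_skew:
  assumes p: "p \<in> U" and X: "VF X"
  shows "g p (D X (e i) p) (e j p) = - g p (D X (e j) p) (e i p)"
proof -
  have "X p (\<lambda>q. g q (e i q) (e j q)) = X p (\<lambda>q. if i = j then 1 else 0)"
    by (rule VF_apply_cong[OF p X]) (rule g_e)
  also have "\<dots> = 0" by (rule VF_apply_const[OF p X])
  finally have "g p (D X (e i) p) (e j p) + g p (e i p) (D X (e j) p) = 0"
    using D_metric[OF p X VF_e VF_e] by simp
  then show ?thesis using metric_sym[OF p VF_e VF_D[OF X VF_e], of i j] by simp
qed

text \<open>The metric trace is parallel: \<open>D X (e t)\<close> need not vanish, but its frame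
  coefficients are skew, so contracting them with the two arguments of Q gives opposite
  sums.\<close>

lemma parallel_contraction:
  assumes p: "p \<in> U" and X: "VF X"
    and Q1: "\<And>Y. VF Y \<Longrightarrow> linear_at p (\<lambda>Z. Q Z Y)" and Q2: "\<And>Y. VF Y \<Longrightarrow> linear_at p (\<lambda>Z. Q Y Z)"
  shows "(\<Sum>t\<in>UNIV. Q (D X (e t)) (e t)) + (\<Sum>t\<in>UNIV. Q (e t) (D X (e t))) = 0"
proof -
  have "(\<Sum>t\<in>UNIV. Q (D X (e t)) (e t)) = (\<Sum>t\<in>UNIV. \<Sum>i\<in>UNIV. g p (D X (e t) p) (e i p) * Q (e i) (e t))"
    by (rule sum.cong[OF refl]) (rule linear_at_frame[OF Q1[OF VF_e] p VF_D[OF X VF_e]])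
  also have "\<dots> = (\<Sum>t\<in>UNIV. \<Sum>i\<in>UNIV. g p (D X (e i) p) (e t p) * Q (e t) (e i))"
    by (rule sum.swap)
  also have "\<dots> = (\<Sum>t\<in>UNIV. \<Sum>i\<in>UNIV. - (g p (D X (e t) p) (e i p) * Q (e t) (e i)))"
    by (subst connection_form_skew[OF p X]) simp
  finally have 1: "(\<Sum>t\<in>UNIV. Q (D X (e t)) (e t))
      = - (\<Sum>t\<in>UNIV. \<Sum>i\<in>UNIV. g p (D X (e t) p) (e i p) * Q (e t) (e i))"
    by (simp add: sum_negf)
  have "(\<Sum>t\<in>UNIV. Q (e t) (D X (e t))) = (\<Sum>t\<in>UNIV. \<Sum>i\<in>UNIV. g p (D X (e t) p) (e i p) * Q (e t) (e i))"
    by (rule sum.cong[OF refl]) (rule linear_at_frame[OF Q2[OF VF_e] p VF_D[OF X VF_e]])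
  with 1 show ?thesis by simp
qed

subsection \<open>Derivatives of full contractions\<close>

text \<open>The Leibniz rule for a full contraction. The moving frame produces corrections in every
  slot; by skewness of the connection forms those of S are the negatives of those of T.\<close>

lemma VF_apply_tensor_inner:
  assumes S: "tensor_on s S" and T: "tensor_on s T" and p: "p \<in> U" and X: "VF X"
  shows "X p (tensor_inner e s S T) = (\<Sum>I\<in>{I. length I = s}.
    cov_deriv D S (map e I @ [X]) p * T (map e I) p + S (map e I) p * cov_deriv D T (map e I @ [X]) p)"
proof -
  let ?L = "{I :: 'n list. length I = s}" and ?\<omega> = "\<lambda>i q. g p (D X (e i) p) (e q p)"
  have SF: "SF (S (map e I))" "SF (T (map e I))" if "length I = s" for I
    using that VF_map_e by (auto intro: SF_tensor[OF S] SF_tensor[OF T])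
  have "X p (tensor_inner e s S T) = X p (\<lambda>q. \<Sum>I\<in>?L. S (map e I) q * T (map e I) q)"
    by (simp add: tensor_inner_def component_def)
  also have "\<dots> = (\<Sum>I\<in>?L. X p (\<lambda>q. S (map e I) q * T (map e I) q))"
    by (rule VF_apply_sum[OF p X]) (use SF SF_mult in blast)
  also have "\<dots> = (\<Sum>I\<in>?L. X p (S (map e I)) * T (map e I) p + S (map e I) p * X p (T (map e I)))"
    by (rule sum.cong[OF refl]) (use VF_apply_mult[OF p X SF] in simp)
  also have "\<dots> = (\<Sum>I\<in>?L. (cov_deriv D S (map e I @ [X]) p * T (map e I) p
        + S (map e I) p * cov_deriv D T (map e I @ [X]) p)
      + ((\<Sum>m<s. S ((map e I)[m := D X (e (I ! m))]) p * T (map e I) p)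
        + (\<Sum>m<s. S (map e I) p * T ((map e I)[m := D X (e (I ! m))]) p)))"
    by (rule sum.cong[OF refl])
      (simp add: cov_deriv_apply algebra_simps sum_distrib_left sum_distrib_right)
  also have "\<dots> = (\<Sum>I\<in>?L. cov_deriv D S (map e I @ [X]) p * T (map e I) p
        + S (map e I) p * cov_deriv D T (map e I @ [X]) p)
      + (\<Sum>m<s. (\<Sum>I\<in>?L. S ((map e I)[m := D X (e (I ! m))]) p * T (map e I) p)
        + (\<Sum>I\<in>?L. S (map e I) p * T ((map e I)[m := D X (e (I ! m))]) p))"
    unfolding sum.distrib by (simp add: sum.swap[of _ _ "{..<s}"])
  also have "(\<Sum>m<s. (\<Sum>I\<in>?L. S ((map e I)[m := D X (e (I ! m))]) p * T (map e I) p)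
        + (\<Sum>I\<in>?L. S (map e I) p * T ((map e I)[m := D X (e (I ! m))]) p)) = 0"
  proof (rule sum.neutral, rule ballI)
    fix m assume "m \<in> {..<s}"
    then have m: "m < s" by simp
    have ex: "R ((map e I)[m := D X (e (I ! m))]) p = (\<Sum>q\<in>UNIV. ?\<omega> (I ! m) q * R (map e (I[m := q])) p)"
      if "length I = s" "tensor_on s R" for R I
      using linear_at_frame[OF linear_at_tensor[OF that(2) _ VF_map_e p m, of I] p VF_D[OF X VF_e[of "I ! m"]]] that(1)
      by (simp add: map_update)
    have "(\<Sum>I\<in>?L. S (map e I) p * T ((map e I)[m := D X (e (I ! m))]) p)
        = (\<Sum>I\<in>?L. \<Sum>q\<in>UNIV. ?\<omega> (I ! m) q * (S (map e I) p * T (map e (I[m := q])) p))"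
      by (rule sum.cong[OF refl]) (simp add: ex[OF _ T] sum_distrib_left algebra_simps)
    also have "\<dots> = (\<Sum>I\<in>?L. \<Sum>q\<in>UNIV. ?\<omega> q (I ! m) * (S (map e (I[m := q])) p * T (map e I) p))"
      by (subst sum_lists_slot_swap[OF m]) (use m in \<open>auto intro!: sum.cong\<close>)
    also have "\<dots> = (\<Sum>I\<in>?L. \<Sum>q\<in>UNIV. - (?\<omega> (I ! m) q * (S (map e (I[m := q])) p * T (map e I) p)))"
      by (intro sum.cong refl) (subst connection_form_skew[OF p X], simp)
    also have "\<dots> = - (\<Sum>I\<in>?L. S ((map e I)[m := D X (e (I ! m))]) p * T (map e I) p)"
      by (subst sum_negf[symmetric], rule sum.cong[OF refl]) (simp add: ex[OF _ S] sum_distrib_left sum_negf mult.left_commute mult.commute)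
    finally show "(\<Sum>I\<in>?L. S ((map e I)[m := D X (e (I ! m))]) p * T (map e I) p)
        + (\<Sum>I\<in>?L. S (map e I) p * T ((map e I)[m := D X (e (I ! m))]) p) = 0" by simp
  qed
  finally show ?thesis by simp
qed

lemma laplacian_apply:
  "laplacian D e f p = (\<Sum>t\<in>UNIV. e t p (\<lambda>q. e t q f) - D (e t) (e t) p f)"
proof -
  have "cov_deriv D (cov_deriv D (\<lambda>_. f)) [X, Y] p = Y p (\<lambda>q. X q f) - D Y X p f" for X Y
    using cov_deriv_cov_deriv_apply[of D "\<lambda>_. f" "[]" X Y p] cov_deriv_apply[of D "\<lambda>_. f" "[]"]
    by (simp add: cov_deriv_apply[abs_def, of D "\<lambda>_. f" "[]", simplified])
  then show ?thesis by (simp add: laplacian_def tensor_laplacian_def)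
qed

lemma tensor_on_cov_deriv_along:
  assumes "tensor_on s S" "VF X"
  shows "tensor_on s (\<lambda>Xs. cov_deriv D S (Xs @ [X]))"
  by (rule tensor_onI) (use assms SF_cov_deriv linear_at_cov_deriv_slot in auto)

text \<open>Freezing the direction X keeps the rank of S, so the Leibniz rule for contractions can
  be used a second time. A frozen direction is not corrected, whence the additional term.\<close>

lemma cov_deriv_cov_deriv_along:
  "cov_deriv D (\<lambda>Xs. cov_deriv D S (Xs @ [X])) (Xs @ [Y]) p
    = cov_deriv D (cov_deriv D S) (Xs @ [X, Y]) p + cov_deriv D S (Xs @ [D Y X]) p"
  by (simp add: cov_deriv_cov_deriv_apply cov_deriv_apply[of D "\<lambda>Xs. cov_deriv D S (Xs @ [X])"])

text \<open>\<open>D (e t) (e t)\<close> enters with opposite signs from the Hessian of the function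
  and from freezing the direction \<open>e t\<close>, so the frame may be arbitrary.\<close>

lemma laplacian_norm_sq:
  assumes S: "tensor_on s S" and p: "p \<in> U"
  shows "1/2 * laplacian D e (tensor_norm_sq e s S) p
    = tensor_norm_sq e (Suc s) (cov_deriv D S) p + tensor_inner e s S (tensor_laplacian D e S) p"
proof -
  let ?L = "{I :: 'n list. length I = s}" and ?N = "tensor_norm_sq e s S"
  have d: "X q ?N = 2 * tensor_inner e s (\<lambda>Xs. cov_deriv D S (Xs @ [X])) S q" if "VF X" "q \<in> U" for X q
    unfolding tensor_norm_sq_def VF_apply_tensor_inner[OF S S that(2,1)]
    by (simp add: tensor_inner_def component_def sum_distrib_left algebra_simps)
  have "e t p (\<lambda>q. e t q ?N) - D (e t) (e t) p ?N
    = 2 * (\<Sum>I\<in>?L. (cov_deriv D S (map e I @ [e t]) p)\<^sup>2)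
      + 2 * (\<Sum>I\<in>?L. S (map e I) p * cov_deriv D (cov_deriv D S) (map e I @ [e t, e t]) p)" for t
  proof -
    let ?S = "\<lambda>Xs. cov_deriv D S (Xs @ [e t])"
    have T: "tensor_on s ?S" by (rule tensor_on_cov_deriv_along[OF S VF_e])
    have SF: "SF (tensor_inner e s ?S S)"
      unfolding tensor_inner_def component_def
      by (rule SF_sum) (use SF_mult SF_tensor[OF S _ VF_map_e] SF_tensor[OF T _ VF_map_e] in auto)
    have "e t p (\<lambda>q. e t q ?N) = e t p (\<lambda>q. 2 * tensor_inner e s ?S S q)"
      by (rule VF_apply_cong[OF p VF_e]) (rule d[OF VF_e])
    also have "\<dots> = 2 * e t p (tensor_inner e s ?S S)"
      using VF_apply_mult[OF p VF_e SF_const SF, of t 2] VF_apply_const[OF p VF_e, of t 2] by simp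
    finally show ?thesis
      unfolding d[OF VF_D[OF VF_e VF_e] p] VF_apply_tensor_inner[OF T S p VF_e]
      by (simp add: cov_deriv_cov_deriv_along tensor_inner_def component_def sum.distrib sum_distrib_left
          algebra_simps power2_eq_square)
  qed
  then have "1/2 * laplacian D e ?N p = (\<Sum>t\<in>UNIV. \<Sum>I\<in>?L. (cov_deriv D S (map e I @ [e t]) p)\<^sup>2)
      + (\<Sum>t\<in>UNIV. \<Sum>I\<in>?L. S (map e I) p * cov_deriv D (cov_deriv D S) (map e I @ [e t, e t]) p)"
    by (simp add: laplacian_apply sum.distrib sum_distrib_left[symmetric] distrib_left)
  also have "(\<Sum>t\<in>UNIV. \<Sum>I\<in>?L. (cov_deriv D S (map e I @ [e t]) p)\<^sup>2) = tensor_norm_sq e (Suc s) (cov_deriv D S) p"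
    unfolding tensor_norm_sq_def tensor_inner_def sum_lists_snoc
    by (subst sum.swap) (simp add: component_def power2_eq_square)
  also have "(\<Sum>t\<in>UNIV. \<Sum>I\<in>?L. S (map e I) p * cov_deriv D (cov_deriv D S) (map e I @ [e t, e t]) p)
      = tensor_inner e s S (tensor_laplacian D e S) p"
    by (subst sum.swap) (simp add: tensor_inner_def component_def tensor_laplacian_def sum_distrib_left)
  finally show ?thesis .
qed

text \<open>The corrections in the two traced slots cancel by \<open>parallel_contraction\<close>;
  the slots of T match term by term.\<close>

lemma cov_deriv_tensor_laplacian:
  assumes T: "tensor_on r T" and Xs: "length Xs = r" "list_all VF Xs" and X: "VF X" and p: "p \<in> U"
  shows "cov_deriv D (tensor_laplacian D e T) (Xs @ [X]) p
    = (\<Sum>t\<in>UNIV. cov_deriv D (cov_deriv D (cov_deriv D T)) (Xs @ [e t, e t, X]) p)"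
proof -
  let ?T2 = "cov_deriv D (cov_deriv D T)"
  note T2 = tensor_on_cov_deriv[OF tensor_on_cov_deriv[OF T]]
  have "X p (tensor_laplacian D e T Xs) = (\<Sum>t\<in>UNIV. X p (?T2 (Xs @ [e t, e t])))"
    unfolding tensor_laplacian_def
    by (rule VF_apply_sum[OF p X]) (rule SF_tensor[OF T2], use Xs VF_e in auto)
  moreover have "(\<Sum>m<length Xs. \<Sum>t\<in>UNIV. ?T2 (Xs[m := D X (Xs ! m)] @ [e t, e t]) p)
      = (\<Sum>t\<in>UNIV. \<Sum>m<length Xs. ?T2 (Xs[m := D X (Xs ! m)] @ [e t, e t]) p)"
    by (rule sum.swap)
  moreover have "(\<Sum>t\<in>UNIV. ?T2 (Xs @ [D X (e t), e t]) p) + (\<Sum>t\<in>UNIV. ?T2 (Xs @ [e t, D X (e t)]) p) = 0"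
  proof (rule parallel_contraction[OF p X])
    fix Y assume Y: "VF Y"
    have l: "length (Xs @ [Y, Y]) = Suc (Suc r)" "list_all VF (Xs @ [Y, Y])" using Xs Y by auto
    show "linear_at p (\<lambda>Z. ?T2 (Xs @ [Z, Y]) p)"
      using linear_at_tensor[OF T2 l p, of r] Xs(1) by (simp add: list_update_append)
    show "linear_at p (\<lambda>Z. ?T2 (Xs @ [Y, Z]) p)"
      using linear_at_tensor[OF T2 l p, of "Suc r"] Xs(1) by (simp add: list_update_append)
  qed
  ultimately show ?thesis
    unfolding cov_deriv3_apply cov_deriv_apply[of D "tensor_laplacian D e T"]
    by (simp add: tensor_laplacian_def sum_subtractf)
qed

subsection \<open>Einstein metrics\<close>

text \<open>Lowering an index with the parallel metric identifies \<open>cov_curv\<close> with the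
  derivative of the (0,4) tensor. In this form the symmetries of the Riemann tensor pass to its
  derivative.\<close>

lemma cov_curv_metric:
  assumes p: "p \<in> U" and V: "VF V" and X: "VF X" and Y: "VF Y" and Z: "VF Z" and W: "VF W"
  shows "g p (W p) (cov_curv V X Y Z p) = V p (\<lambda>q. rm q W Z X Y) - rm p (D V W) Z X Y
    - rm p W (D V Z) X Y - rm p W Z (D V X) Y - rm p W Z X (D V Y)"
proof -
  note L = linear_at_metric_right[OF p W]
  note a = VF_D[OF V VF_curv[OF X Y Z]] VF_curv[OF VF_D[OF V X] Y Z] VF_curv[OF X VF_D[OF V Y] Z]
    VF_curv[OF X Y VF_D[OF V Z]]
  show ?thesis
    unfolding cov_curv_def
    using linear_at_diff[OF L VF_diff[OF VF_diff[OF a(1,2)] a(3)] a(4)]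
      linear_at_diff[OF L VF_diff[OF a(1,2)] a(3)] linear_at_diff[OF L a(1,2)]
      D_metric[OF p V W VF_curv[OF X Y Z]] by linarith
qed

lemma cov_curv_pair_sym:
  assumes p: "p \<in> U" and V: "VF V" and X: "VF X" and Y: "VF Y" and Z: "VF Z" and W: "VF W"
  shows "g p (W p) (cov_curv V X Y Z p) = g p (X p) (cov_curv V W Z Y p)"
proof -
  have "V p (\<lambda>q. rm q W Z X Y) = V p (\<lambda>q. rm q X Y W Z)"
    by (rule VF_apply_cong[OF p V]) (rule rm_pair_sym[OF _ W Z X Y])
  then show ?thesis
    unfolding cov_curv_metric[OF p V X Y Z W] cov_curv_metric[OF p V W Z Y X]
    using rm_pair_sym[OF p VF_D[OF V W] Z X Y] rm_pair_sym[OF p W VF_D[OF V Z] X Y]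
      rm_pair_sym[OF p W Z VF_D[OF V X] Y] rm_pair_sym[OF p W Z X VF_D[OF V Y]] by linarith
qed

lemma cov_curv_swap:
  assumes p: "p \<in> U" and V: "VF V" and X: "VF X" and Y: "VF Y" and Z: "VF Z" and W: "VF W"
  shows "g p (W p) (cov_curv V X Y Z p) = - g p (W p) (cov_curv V Y X Z p)"
proof -
  have "V p (\<lambda>q. rm q W Z X Y) = V p (\<lambda>q. (- 1) * rm q W Z Y X)"
    by (rule VF_apply_cong[OF p V]) (use rm_swap34[OF _ W Z X Y] in simp)
  also have "\<dots> = - V p (\<lambda>q. rm q W Z Y X)"
    using VF_apply_mult[OF p V SF_const SF_metric[OF W VF_curv[OF Y X Z]], of "-1"]
      VF_apply_const[OF p V, of "-1"] by simp
  finally show ?thesis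
    unfolding cov_curv_metric[OF p V X Y Z W] cov_curv_metric[OF p V Y X Z W]
    using rm_swap34[OF p VF_D[OF V W] Z X Y] rm_swap34[OF p W VF_D[OF V Z] X Y]
      rm_swap34[OF p W Z VF_D[OF V X] Y] rm_swap34[OF p W Z X VF_D[OF V Y]] by linarith
qed

end

locale einstein_framed = framed +
  fixes c :: real
  assumes ricci_const: "\<And>X Y p. VF X \<Longrightarrow> VF Y \<Longrightarrow> p \<in> U
    \<Longrightarrow> (\<Sum>t\<in>UNIV. rm p X (e t) Y (e t)) = c * g p (X p) (Y p)"
begin

text \<open>Ric = c g is differentiated with c constant; the metric and the trace over the frame are
  both parallel.\<close>

lemma cov_ricci_zero:
  assumes p: "p \<in> U" and V: "VF V" and X: "VF X" and Y: "VF Y"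
  shows "(\<Sum>t\<in>UNIV. g p (X p) (cov_curv V Y (e t) (e t) p)) = 0"
proof -
  have "(\<Sum>t\<in>UNIV. V p (\<lambda>q. rm q X (e t) Y (e t))) = V p (\<lambda>q. \<Sum>t\<in>UNIV. rm q X (e t) Y (e t))"
    by (rule VF_apply_sum[OF p V, symmetric]) (rule SF_metric[OF X VF_curv[OF Y VF_e VF_e]])
  also have "\<dots> = V p (\<lambda>q. c * g q (X q) (Y q))"
    by (rule VF_apply_cong[OF p V]) (rule ricci_const[OF X Y])
  also have "\<dots> = c * (g p (D V X p) (Y p) + g p (X p) (D V Y p))"
    using VF_apply_mult[OF p V SF_const SF_metric[OF X Y], of c] VF_apply_const[OF p V, of c] D_metric[OF p V X Y]
    by simp
  finally have 1: "(\<Sum>t\<in>UNIV. V p (\<lambda>q. rm q X (e t) Y (e t)))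
      = c * g p (D V X p) (Y p) + c * g p (X p) (D V Y p)" by (simp add: distrib_left)
  have 2: "(\<Sum>t\<in>UNIV. rm p X (D V (e t)) Y (e t)) + (\<Sum>t\<in>UNIV. rm p X (e t) Y (D V (e t))) = 0"
    by (rule parallel_contraction[OF p V]) (rule linear_at_rm2[OF p X Y], assumption, rule linear_at_rm4[OF p X _ Y])
  show ?thesis
    unfolding cov_curv_metric[OF p V Y VF_e VF_e X] sum_subtractf
    using 1 2 ricci_const[OF VF_D[OF V X] Y p] ricci_const[OF X VF_D[OF V Y] p] by linarith
qed

text \<open>The contracted second Bianchi identity. Pair symmetry turns the divergence into one term
  of a cyclic sum whose other two terms trace to derivatives of the Ricci tensor, and these are
  zero.\<close>

lemma cov_curv_divergence_free:
  assumes p: "p \<in> U" and X: "VF X" and Z: "VF Z" and L: "linear_at p \<Phi>"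
  shows "(\<Sum>t\<in>UNIV. \<Phi> (cov_curv (e t) X (e t) Z)) = 0"
proof -
  have z: "(\<Sum>t\<in>UNIV. g p (W p) (cov_curv (e t) X (e t) Z p)) = 0" if W: "VF W" for W
  proof -
    have "g p (W p) (cov_curv (e t) X (e t) Z p)
        = - g p (X p) (cov_curv W Z (e t) (e t) p) + g p (X p) (cov_curv Z W (e t) (e t) p)" for t
    proof -
      note L = linear_at_metric_right[OF p X]
      let ?B = "vf_add (vf_add (cov_curv (e t) W Z (e t)) (cov_curv W Z (e t) (e t))) (cov_curv Z (e t) W (e t))"
      have B: "cov_curv (e t) W Z (e t) q f + cov_curv W Z (e t) (e t) q f + cov_curv Z (e t) W (e t) q f = 0"
        if "q \<in> U" for q f
        by (rule second_bianchi[OF that VF_e W Z VF_e])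
      have "g p (X p) (?B p) = 0"
        by (rule linear_at_zero[OF L p]) (simp add: fun_eq_iff B)
      then have "g p (X p) (cov_curv (e t) W Z (e t) p) + g p (X p) (cov_curv W Z (e t) (e t) p)
          + g p (X p) (cov_curv Z (e t) W (e t) p) = 0"
        using linear_at_add[OF L VF_add[OF VF_cov_curv[OF VF_e W Z VF_e] VF_cov_curv[OF W Z VF_e VF_e]] VF_cov_curv[OF Z VF_e W VF_e], of t t t t t]
          linear_at_add[OF L VF_cov_curv[OF VF_e W Z VF_e] VF_cov_curv[OF W Z VF_e VF_e], of t t t t] by simp
      then show ?thesis
        using cov_curv_pair_sym[OF p VF_e X VF_e Z W, of t t] cov_curv_swap[OF p Z VF_e W VF_e X, of t t] by linarith
    qed
    then show ?thesis
      using cov_ricci_zero[OF p W X Z] cov_ricci_zero[OF p Z X W] by (simp add: sum_subtractf)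
  qed
  have "(\<Sum>t\<in>UNIV. \<Phi> (cov_curv (e t) X (e t) Z))
      = (\<Sum>t\<in>UNIV. \<Sum>i\<in>UNIV. g p (e i p) (cov_curv (e t) X (e t) Z p) * \<Phi> (e i))"
    by (intro sum.cong refl)
      (simp add: linear_at_frame[OF L p VF_cov_curv[OF VF_e X VF_e Z]] metric_sym[OF p VF_e VF_cov_curv[OF VF_e X VF_e Z]])
  also have "\<dots> = (\<Sum>i\<in>UNIV. (\<Sum>t\<in>UNIV. g p (e i p) (cov_curv (e t) X (e t) Z p)) * \<Phi> (e i))"
    by (subst sum.swap) (simp add: sum_distrib_right)
  also have "\<dots> = 0" by (simp add: z[OF VF_e])
  finally show ?thesis .
qed

text \<open>The frame sum of \<open>curv X (e t) (e t)\<close> is the Ricci operator applied to X;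
  \<Phi> stands for the slot of a tensor in which this vector occurs.\<close>

lemma ricci_trace:
  assumes p: "p \<in> U" and X: "VF X" and L: "linear_at p \<Phi>"
  shows "(\<Sum>t\<in>UNIV. \<Phi> (curv X (e t) (e t))) = c * \<Phi> X"
proof -
  have "(\<Sum>t\<in>UNIV. \<Phi> (curv X (e t) (e t))) = (\<Sum>t\<in>UNIV. \<Sum>i\<in>UNIV. rm p (e i) (e t) X (e t) * \<Phi> (e i))"
    by (intro sum.cong refl)
      (simp add: linear_at_frame[OF L p VF_curv[OF X VF_e VF_e]] metric_sym[OF p VF_e VF_curv[OF X VF_e VF_e]])
  also have "\<dots> = (\<Sum>i\<in>UNIV. c * g p (e i p) (X p) * \<Phi> (e i))"
    by (subst sum.swap) (simp add: sum_distrib_right[symmetric] ricci_const[OF VF_e X p])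
  also have "\<dots> = c * \<Phi> X"
    by (simp add: linear_at_frame[OF L p X] sum_distrib_left metric_sym[OF p VF_e X] mult.assoc)
  finally show ?thesis .
qed

lemma laplacian_cov_deriv_commute:
  assumes T: "tensor_on r T" and Xs: "length Xs = r" "list_all VF Xs" and X: "VF X" and p: "p \<in> U"
  shows "tensor_laplacian D e (cov_deriv D T) (Xs @ [X]) p - cov_deriv D (tensor_laplacian D e T) (Xs @ [X]) p
    = 2 * (\<Sum>m<r. \<Sum>t\<in>UNIV. cov_deriv D T (Xs[m := curv X (e t) (Xs ! m)] @ [e t]) p)
      + c * cov_deriv D T (Xs @ [X]) p"
proof -
  let ?T3 = "cov_deriv D (cov_deriv D (cov_deriv D T))"
  let ?K = "\<lambda>m t. cov_deriv D T (Xs[m := curv X (e t) (Xs ! m)] @ [e t]) p"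
  have 1: "(\<Sum>t\<in>UNIV. ?T3 (Xs @ [X, e t, e t]) p - ?T3 (Xs @ [e t, X, e t]) p) = (\<Sum>m<r. \<Sum>t\<in>UNIV. ?K m t)"
  proof -
    have "(\<Sum>t\<in>UNIV. T (Xs[m := cov_curv (e t) X (e t) (Xs ! m)]) p) = 0" if "m < r" for m
      using cov_curv_divergence_free[OF p X VF_nth[OF Xs(2)] linear_at_tensor[OF T Xs p that], of m] that Xs(1)
      by simp
    then have "(\<Sum>m<r. \<Sum>t\<in>UNIV. T (Xs[m := cov_curv (e t) X (e t) (Xs ! m)]) p) = 0" by simp
    moreover have "(\<Sum>t\<in>UNIV. ?T3 (Xs @ [X, e t, e t]) p - ?T3 (Xs @ [e t, X, e t]) p)
        = (\<Sum>t\<in>UNIV. \<Sum>m<r. ?K m t + T (Xs[m := cov_curv (e t) X (e t) (Xs ! m)]) p)"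
      by (rule sum.cong[OF refl]) (rule cov_deriv_ricci_identity[OF T Xs X VF_e VF_e p])
    ultimately show ?thesis
      by (simp add: sum.distrib sum.swap[of _ "{..<r}"])
  qed
  have 2: "(\<Sum>t\<in>UNIV. ?T3 (Xs @ [e t, X, e t]) p - ?T3 (Xs @ [e t, e t, X]) p)
      = (\<Sum>m<r. \<Sum>t\<in>UNIV. ?K m t) + c * cov_deriv D T (Xs @ [X]) p"
  proof -
    have "?T3 (Xs @ [e t, X, e t]) p - ?T3 (Xs @ [e t, e t, X]) p
        = (\<Sum>m<r. ?K m t) + cov_deriv D T (Xs @ [curv X (e t) (e t)]) p" for t
    proof -
      \<comment> \<open>For the tensor \<nabla>T the inner \<open>e t\<close> is one more argument:
        its slot yields the Ricci trace, while the first r slots repeat the terms of the other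
        commutation.\<close>
      have "?T3 ((Xs @ [e t]) @ [X, e t]) p - ?T3 ((Xs @ [e t]) @ [e t, X]) p
          = (\<Sum>m<Suc r. cov_deriv D T ((Xs @ [e t])[m := curv X (e t) ((Xs @ [e t]) ! m)]) p)"
        by (rule ricci_identity[OF tensor_on_cov_deriv[OF T] _ _ X VF_e p]) (use Xs VF_e in auto)
      then show ?thesis using Xs(1) by (simp add: list_update_append nth_append)
    qed
    then show ?thesis
      using ricci_trace[OF p X linear_at_cov_deriv_last[OF T Xs p]]
      by (simp add: sum.distrib sum.swap[of _ "{..<r}"])
  qed
  have 3: "tensor_laplacian D e (cov_deriv D T) (Xs @ [X]) p = (\<Sum>t\<in>UNIV. ?T3 (Xs @ [X, e t, e t]) p)"
    by (simp add: tensor_laplacian_def)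
  show ?thesis
    unfolding 3 cov_deriv_tensor_laplacian[OF T Xs X p]
    using 1 2 by (simp add: sum_subtractf)
qed

theorem bochner_formula:
  assumes T: "tensor_on r T" and p: "p \<in> U"
  shows "1/2 * laplacian D e (tensor_norm_sq e (Suc r) (cov_deriv D T)) p
    = tensor_norm_sq e (Suc (Suc r)) (cov_deriv D (cov_deriv D T)) p
    + tensor_inner e (Suc r) (cov_deriv D T) (cov_deriv D (tensor_laplacian D e T)) p
    + c * tensor_norm_sq e (Suc r) (cov_deriv D T) p
    + 2 * (\<Sum>m<r. \<Sum>I\<in>{I. length I = r}. \<Sum>i\<in>UNIV. \<Sum>q\<in>UNIV. \<Sum>t\<in>UNIV.
        component e (cov_deriv D T) (I @ [i]) p * component e (cov_deriv D T) (I[m := q] @ [t]) p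
          * rm p (e q) (e (I ! m)) (e i) (e t))"
proof -
  let ?L = "{I :: 'n list. length I = r}" and ?S = "cov_deriv D T"
  let ?S' = "\<lambda>I. component e (cov_deriv D T) I p"
  \<comment> \<open>The curvature vector is expanded in the frame with index q; symmetry of the
    metric moves q to the first position of the Riemann tensor.\<close>
  have K: "?S ((map e I)[m := curv (e i) (e t) (e (I ! m))] @ [e t]) p
      = (\<Sum>q\<in>UNIV. rm p (e q) (e (I ! m)) (e i) (e t) * ?S' (I[m := q] @ [t]))" if "length I = r" "m < r" for I m i t
    using linear_at_frame[OF linear_at_cov_deriv_slot[OF T _ VF_map_e VF_e p that(2), of I t] p VF_curv[OF VF_e VF_e VF_e]]
      that metric_sym[OF p VF_e VF_curv[OF VF_e VF_e VF_e]]
    by (simp add: component_def map_update)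
  have "tensor_laplacian D e ?S (map e I @ [e i]) p = cov_deriv D (tensor_laplacian D e T) (map e I @ [e i]) p
      + c * ?S' (I @ [i]) + 2 * (\<Sum>m<r. \<Sum>t\<in>UNIV. \<Sum>q\<in>UNIV. rm p (e q) (e (I ! m)) (e i) (e t) * ?S' (I[m := q] @ [t]))"
    if I: "length I = r" for I i
    using laplacian_cov_deriv_commute[OF T _ VF_map_e VF_e p, of I i] I K[OF I] by (simp add: component_def)
  then have "tensor_inner e (Suc r) ?S (tensor_laplacian D e ?S) p
      = (\<Sum>I\<in>?L. \<Sum>i\<in>UNIV. ?S' (I @ [i]) * cov_deriv D (tensor_laplacian D e T) (map e I @ [e i]) p
        + c * (?S' (I @ [i]) * ?S' (I @ [i]))
        + 2 * (\<Sum>m<r. \<Sum>t\<in>UNIV. \<Sum>q\<in>UNIV. ?S' (I @ [i]) * ?S' (I[m := q] @ [t]) * rm p (e q) (e (I ! m)) (e i) (e t)))"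
    unfolding tensor_inner_def sum_lists_snoc
    by (intro sum.cong refl) (simp add: component_def algebra_simps sum_distrib_left)
  also have "\<dots> = tensor_inner e (Suc r) ?S (cov_deriv D (tensor_laplacian D e T)) p
    + c * tensor_norm_sq e (Suc r) ?S p
    + 2 * (\<Sum>I\<in>?L. \<Sum>i\<in>UNIV. \<Sum>m<r. \<Sum>t\<in>UNIV. \<Sum>q\<in>UNIV. ?S' (I @ [i]) * ?S' (I[m := q] @ [t]) * rm p (e q) (e (I ! m)) (e i) (e t))"
    unfolding tensor_inner_def tensor_norm_sq_def sum_lists_snoc
    by (simp add: sum.distrib sum_distrib_left component_def)
  also have "(\<Sum>I\<in>?L. \<Sum>i\<in>UNIV. \<Sum>m<r. \<Sum>t\<in>UNIV. \<Sum>q\<in>UNIV. ?S' (I @ [i]) * ?S' (I[m := q] @ [t]) * rm p (e q) (e (I ! m)) (e i) (e t))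
     = (\<Sum>m<r. \<Sum>I\<in>?L. \<Sum>i\<in>UNIV. \<Sum>q\<in>UNIV. \<Sum>t\<in>UNIV. ?S' (I @ [i]) * ?S' (I[m := q] @ [t]) * rm p (e q) (e (I ! m)) (e i) (e t))"
  proof -
    have "(\<Sum>I\<in>?L. \<Sum>i\<in>UNIV. \<Sum>m<r. G I i m) = (\<Sum>m<r. \<Sum>I\<in>?L. \<Sum>i\<in>UNIV. G I i m)" for G :: "'n list \<Rightarrow> 'n \<Rightarrow> nat \<Rightarrow> real"
    proof -
      have "(\<Sum>I\<in>?L. \<Sum>i\<in>UNIV. \<Sum>m<r. G I i m) = (\<Sum>I\<in>?L. \<Sum>m<r. \<Sum>i\<in>UNIV. G I i m)"
        by (intro sum.cong refl sum.swap)
      also have "\<dots> = (\<Sum>m<r. \<Sum>I\<in>?L. \<Sum>i\<in>UNIV. G I i m)" by (rule sum.swap)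
      finally show ?thesis .
    qed
    note swap = this
    show ?thesis by (rule trans[OF swap]) (intro sum.cong refl sum.swap)
  qed
  finally show ?thesis
    using laplacian_norm_sq[OF tensor_on_cov_deriv[OF T] p] by simp
qed

end

section \<open>The Weyl tensor\<close>

lemma sum_swap_last:
  fixes H :: "'n::finite \<Rightarrow> 'n \<Rightarrow> 'n \<Rightarrow> 'n \<Rightarrow> 'b::comm_monoid_add"
  shows "(\<Sum>a\<in>UNIV. \<Sum>b\<in>UNIV. \<Sum>c\<in>UNIV. \<Sum>d\<in>UNIV. H a b d c)
    = (\<Sum>a\<in>UNIV. \<Sum>b\<in>UNIV. \<Sum>c\<in>UNIV. \<Sum>d\<in>UNIV. H a b c d)"
  by (rule sum.cong[OF refl], rule sum.cong[OF refl], rule sum.swap)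

text \<open>Relabels the indices of the sums belonging to slots 0 and 1, which arise with the two
  index pairs exchanged.\<close>

lemma sum_swap_pairs:
  fixes H :: "'n::finite \<Rightarrow> 'n \<Rightarrow> 'n \<Rightarrow> 'n \<Rightarrow> 'b::comm_monoid_add"
  shows "(\<Sum>a\<in>UNIV. \<Sum>b\<in>UNIV. \<Sum>c\<in>UNIV. \<Sum>d\<in>UNIV. H c d a b)
    = (\<Sum>a\<in>UNIV. \<Sum>b\<in>UNIV. \<Sum>c\<in>UNIV. \<Sum>d\<in>UNIV. H a b c d)"
proof -
  have "(\<Sum>a\<in>UNIV. \<Sum>b\<in>UNIV. \<Sum>c\<in>UNIV. \<Sum>d\<in>UNIV. H c d a b)
      = (\<Sum>a\<in>UNIV. \<Sum>c\<in>UNIV. \<Sum>b\<in>UNIV. \<Sum>d\<in>UNIV. H c d a b)"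
    by (rule sum.cong[OF refl], rule sum.swap)
  also have "\<dots> = (\<Sum>c\<in>UNIV. \<Sum>a\<in>UNIV. \<Sum>b\<in>UNIV. \<Sum>d\<in>UNIV. H c d a b)"
    by (rule sum.swap)
  also have "\<dots> = (\<Sum>c\<in>UNIV. \<Sum>a\<in>UNIV. \<Sum>d\<in>UNIV. \<Sum>b\<in>UNIV. H c d a b)"
    by (rule sum.cong[OF refl], rule sum.cong[OF refl], rule sum.swap)
  also have "\<dots> = (\<Sum>c\<in>UNIV. \<Sum>d\<in>UNIV. \<Sum>a\<in>UNIV. \<Sum>b\<in>UNIV. H c d a b)"
    by (rule sum.cong[OF refl], rule sum.swap)
  finally show ?thesis .
qed

context levi_civita_on
begin

text \<open>The symmetries are only required of the first four arguments; \<open>r\<close> counts the remaining ones.\<close>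

definition curvature_type :: "nat \<Rightarrow> 'a tensor \<Rightarrow> bool" where
  "curvature_type r T \<longleftrightarrow> (\<forall>X Y Z W Xs. \<forall>q\<in>U. list_all VF [X, Y, Z, W] \<longrightarrow> list_all VF Xs \<longrightarrow> length Xs = r \<longrightarrow>
     T ([X, Y, Z, W] @ Xs) q = - T ([Y, X, Z, W] @ Xs) q \<and>
     T ([X, Y, Z, W] @ Xs) q = T ([Z, W, X, Y] @ Xs) q)"

lemma curvature_typeD:
  assumes "curvature_type r T" "q \<in> U" "VF X" "VF Y" "VF Z" "VF W" "list_all VF Xs" "length Xs = r"
  shows "T (X # Y # Z # W # Xs) q = - T (Y # X # Z # W # Xs) q"
    and "T (X # Y # Z # W # Xs) q = T (Z # W # X # Y # Xs) q"
proof -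
  have "T ([X, Y, Z, W] @ Xs) q = - T ([Y, X, Z, W] @ Xs) q \<and> T ([X, Y, Z, W] @ Xs) q = T ([Z, W, X, Y] @ Xs) q"
    by (rule assms(1)[unfolded curvature_type_def, THEN spec, THEN spec, THEN spec, THEN spec, THEN spec,
          THEN bspec, THEN mp, THEN mp, THEN mp]) (simp_all add: assms)
  then show "T (X # Y # Z # W # Xs) q = - T (Y # X # Z # W # Xs) q"
    and "T (X # Y # Z # W # Xs) q = T (Z # W # X # Y # Xs) q" by simp_all
qed

lemma cov_deriv_apply4:
  "cov_deriv D T (X # Y # Z # W # Xs @ [V]) p = V p (T (X # Y # Z # W # Xs))
    - (T (D V X # Y # Z # W # Xs) p + T (X # D V Y # Z # W # Xs) p + T (X # Y # D V Z # W # Xs) p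
      + T (X # Y # Z # D V W # Xs) p + (\<Sum>m<length Xs. T (X # Y # Z # W # Xs[m := D V (Xs ! m)]) p))"
  using cov_deriv_apply[of D T "X # Y # Z # W # Xs" V p]
  by (simp add: sum.lessThan_Suc_shift algebra_simps del: sum.lessThan_Suc)

text \<open>The symmetries relate permuted arguments, and \<open>cov_deriv\<close> treats all slots
  alike: each correction satisfies the relation on its own once its field is followed to the slot
  where the permutation puts it.\<close>

lemma curvature_type_cov_deriv:
  assumes T: "tensor_on (4 + r) T" and C: "curvature_type r T"
  shows "curvature_type (Suc r) (cov_deriv D T)"
  unfolding curvature_type_def
proof (intro allI ballI impI conjI)
  fix X Y Z W Ys q
  assume q: "q \<in> U" and l: "list_all VF [X, Y, Z, W]" and Ys: "list_all VF Ys" "length Ys = Suc r"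
  then have F: "VF X" "VF Y" "VF Z" "VF W" by auto
  obtain Xs V where eq: "Ys = Xs @ [V]" using Ys(2) by (metis length_0_conv nat.distinct(1) rev_exhaust)
  have Xs: "list_all VF Xs" "length Xs = r" and V: "VF V" using Ys eq by auto
  note s = curvature_typeD[OF C]
  have up: "list_all VF (Xs[m := D V (Xs ! m)])" "length (Xs[m := D V (Xs ! m)]) = r" if "m < length Xs" for m
    using VF_update[OF Xs(1) VF_D[OF V VF_nth[OF Xs(1) that]]] Xs(2) by auto
  have "V q (T (X # Y # Z # W # Xs)) = V q (\<lambda>q. (- 1) * T (Y # X # Z # W # Xs) q)"
    by (rule VF_apply_cong[OF q V]) (simp add: s(1)[OF _ F Xs])
  also have "\<dots> = - V q (T (Y # X # Z # W # Xs))"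
    using VF_apply_mult[OF q V SF_const[of "-1"] SF_tensor[OF T, of "Y # X # Z # W # Xs"]]
      VF_apply_const[OF q V, of "-1"] F Xs by simp
  finally have V1: "V q (T (X # Y # Z # W # Xs)) = - V q (T (Y # X # Z # W # Xs))" .
  have V2: "V q (T (X # Y # Z # W # Xs)) = V q (T (Z # W # X # Y # Xs))"
    by (rule VF_apply_cong[OF q V]) (rule s(2)[OF _ F Xs])
  have "(\<Sum>m<length Xs. T (X # Y # Z # W # Xs[m := D V (Xs ! m)]) q)
      = (\<Sum>m<length Xs. - T (Y # X # Z # W # Xs[m := D V (Xs ! m)]) q)"
    by (rule sum.cong[OF refl]) (rule s(1)[OF q F up], auto)
  then have S1: "(\<Sum>m<length Xs. T (X # Y # Z # W # Xs[m := D V (Xs ! m)]) q)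
      = - (\<Sum>m<length Xs. T (Y # X # Z # W # Xs[m := D V (Xs ! m)]) q)" by (simp add: sum_negf)
  have S2: "(\<Sum>m<length Xs. T (X # Y # Z # W # Xs[m := D V (Xs ! m)]) q)
      = (\<Sum>m<length Xs. T (Z # W # X # Y # Xs[m := D V (Xs ! m)]) q)"
    by (rule sum.cong[OF refl]) (rule s(2)[OF q F up], auto)
  note d = VF_D[OF V F(1)] VF_D[OF V F(2)] VF_D[OF V F(3)] VF_D[OF V F(4)]
  show "cov_deriv D T ([X, Y, Z, W] @ Ys) q = - cov_deriv D T ([Y, X, Z, W] @ Ys) q"
    using s(1)[OF q d(1) F(2-4) Xs] s(1)[OF q F(1) d(2) F(3,4) Xs] s(1)[OF q F(1,2) d(3) F(4) Xs]
      s(1)[OF q F(1-3) d(4) Xs] V1 S1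
    by (simp add: eq cov_deriv_apply4)
  show "cov_deriv D T ([X, Y, Z, W] @ Ys) q = cov_deriv D T ([Z, W, X, Y] @ Ys) q"
    using s(2)[OF q d(1) F(2-4) Xs] s(2)[OF q F(1) d(2) F(3,4) Xs] s(2)[OF q F(1,2) d(3) F(4) Xs]
      s(2)[OF q F(1-3) d(4) Xs] V2 S2
    by (simp add: eq cov_deriv_apply4)
qed

lemma tensor_on_iterated:
  assumes "tensor_on r T"
  shows "tensor_on (r + k) ((cov_deriv D ^^ k) T)"
  by (induction k) (use assms tensor_on_cov_deriv in auto)

lemma curvature_type_iterated:
  assumes "tensor_on 4 T" "curvature_type 0 T"
  shows "curvature_type k ((cov_deriv D ^^ k) T)"
proof (induction k)
  case (Suc k)
  then show ?case using curvature_type_cov_deriv[OF tensor_on_iterated[OF assms(1)]] by simp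
qed (use assms in simp)

text \<open>Serves to replace the Weyl tensor by a simpler expression with which it is known to
  agree only on fields over U and at points of U.\<close>

lemma tensor_on_cong:
  assumes "tensor_on r T" "\<And>Xs q. length Xs = r \<Longrightarrow> list_all VF Xs \<Longrightarrow> q \<in> U \<Longrightarrow> T Xs q = T' Xs q"
  shows "tensor_on r T'"
proof (rule tensor_onI)
  fix Xs assume Xs: "length Xs = r" "list_all VF Xs"
  show "SF (T' Xs)" by (rule SF_cong[OF SF_tensor[OF assms(1) Xs]]) (rule assms(2)[OF Xs])
  fix p m assume p: "p \<in> U" and m: "m < r"
  have "T' (Xs[m := X]) p = T (Xs[m := X]) p" if "VF X" for X
    using assms(2)[OF _ VF_update[OF Xs(2) that] p] Xs(1) by simp
  then show "linear_at p (\<lambda>X. T' (Xs[m := X]) p)"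
    using linear_at_tensor[OF assms(1) Xs p m] VF_add VF_scale unfolding linear_at_def by simp
qed

text \<open>In dimension four, \<open>Ric = c g\<close> reduces the Weyl tensor to this expression with \<open>k = c / 3\<close>.\<close>

abbreviation weyl_part :: "real \<Rightarrow> 'a vfield \<Rightarrow> 'a vfield \<Rightarrow> 'a vfield \<Rightarrow> 'a vfield \<Rightarrow> 'a \<Rightarrow> real" where
  "weyl_part k X Y Z W p \<equiv> rm p X Y Z W
    - k * (g p (X p) (Z p) * g p (Y p) (W p) - g p (X p) (W p) * g p (Y p) (Z p))"

lemma tensor_on_weyl_part:
  "tensor_on 4 (\<lambda>Xs. weyl_part k (Xs ! 0) (Xs ! 1) (Xs ! 2) (Xs ! 3))"
proof (rule tensor_onI)
  fix Xs :: "'a vfield list" assume Xs: "length Xs = 4" "list_all VF Xs"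
  then obtain X Y Z W where eq: "Xs = [X, Y, Z, W]"
    by (auto simp: numeral_eq_Suc length_Suc_conv)
  then have F: "VF X" "VF Y" "VF Z" "VF W" using Xs by auto
  have "SF (weyl_part k X Y Z W)"
    by (intro SF_diff SF_mult SF_const SF_metric VF_curv F)
  then show "SF (weyl_part k (Xs ! 0) (Xs ! 1) (Xs ! 2) (Xs ! 3))" by (simp add: eq)
  fix p m assume p: "p \<in> U" and m: "m < (4::nat)"
  then have "m = 0 \<or> m = 1 \<or> m = 2 \<or> m = 3" by auto
  moreover have "linear_at p (\<lambda>X. weyl_part k X Y Z W p)"
    by (intro linear_at_minus linear_at_mult_left linear_at_mult_right)
      (rule linear_at_metric_left[OF p]; intro VF_curv F)+
  moreover have "linear_at p (\<lambda>Y. weyl_part k X Y Z W p)"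
    by (intro linear_at_minus linear_at_mult_left)
      (rule linear_at_rm2[OF p F(1,3,4)]
        linear_at_metric_left[OF p F(4)] linear_at_metric_left[OF p F(3)] | assumption)+
  moreover have "linear_at p (\<lambda>Z. weyl_part k X Y Z W p)"
    by (rule linear_at_minus[OF linear_at_rm3[OF p F(1,2,4)]
        linear_at_mult_left[OF linear_at_minus[OF linear_at_mult_right[OF linear_at_metric_right[OF p F(1)]]
        linear_at_mult_left[OF linear_at_metric_right[OF p F(2)]]]]])
  moreover have "linear_at p (\<lambda>W. weyl_part k X Y Z W p)"
    by (rule linear_at_minus[OF linear_at_rm4[OF p F(1,2,3)]
        linear_at_mult_left[OF linear_at_minus[OF linear_at_mult_left[OF linear_at_metric_right[OF p F(2)]]
        linear_at_mult_right[OF linear_at_metric_right[OF p F(1)]]]]])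
  ultimately show "linear_at p (\<lambda>V. weyl_part k (Xs[m := V] ! 0) (Xs[m := V] ! 1) (Xs[m := V] ! 2) (Xs[m := V] ! 3) p)"
    by (elim disjE) (simp_all add: eq numeral_eq_Suc)
qed

lemma weyl_part_symmetries:
  assumes "q \<in> U" "VF X" "VF Y" "VF Z" "VF W"
  shows "weyl_part k X Y Z W q = - weyl_part k Y X Z W q"
    and "weyl_part k X Y Z W q = weyl_part k Z W X Y q"
  using rm_swap12[OF assms] rm_pair_sym[OF assms] metric_sym[OF assms(1,2,4)] metric_sym[OF assms(1,3,5)]
    metric_sym[OF assms(1,2,5)] metric_sym[OF assms(1,3,4)]
  by (simp_all add: algebra_simps)

end

section \<open>Curvature acting on the slots of a tensor with the symmetries of the Weyl
  tensor\<close>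

context framed
begin

text \<open>The symmetries carry each of the first four slots to the fourth. The same permutation is
  applied to both factors, so signs cancel in the product and four equal sums arise.\<close>

lemma curvature_action_sum:
  assumes C: "curvature_type (Suc j) S" and p: "p \<in> U"
  defines "DS \<equiv> \<lambda>I. component e S I p"
  shows "(\<Sum>m<4 + j. \<Sum>I\<in>{I. length I = 4 + j}. \<Sum>i\<in>UNIV. \<Sum>q\<in>UNIV. \<Sum>t\<in>UNIV.
      DS (I @ [i]) * DS (I[m := q] @ [t]) * B q (I ! m) i t)
    = 4 * (\<Sum>a\<in>UNIV. \<Sum>b\<in>UNIV. \<Sum>c\<in>UNIV. \<Sum>d\<in>UNIV. \<Sum>q\<in>UNIV.
             \<Sum>I\<in>{I. length I = j}. \<Sum>i\<in>UNIV. \<Sum>t\<in>UNIV.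
               DS ([a, b, c, d] @ I @ [i]) * DS ([a, b, c, q] @ I @ [t]) * B q d i t)
    + (\<Sum>m<j. \<Sum>a\<in>UNIV. \<Sum>b\<in>UNIV. \<Sum>c\<in>UNIV. \<Sum>d\<in>UNIV.
             \<Sum>I\<in>{I. length I = j}. \<Sum>i\<in>UNIV. \<Sum>q\<in>UNIV. \<Sum>t\<in>UNIV.
               DS ([a, b, c, d] @ I @ [i]) * DS ([a, b, c, d] @ I[m := q] @ [t]) * B q (I ! m) i t)"
proof -
  let ?F = "\<lambda>m I. \<Sum>i\<in>UNIV. \<Sum>q\<in>UNIV. \<Sum>t\<in>UNIV. DS (I @ [i]) * DS (I[m := q] @ [t]) * B q (I ! m) i t"
  let ?J = "{I :: 'n list. length I = j}"
  let ?P = "\<lambda>a b c d. \<Sum>I\<in>?J. \<Sum>i\<in>UNIV. \<Sum>q\<in>UNIV. \<Sum>t\<in>UNIV.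
      DS ([a, b, c, d] @ I @ [i]) * DS ([a, b, c, q] @ I @ [t]) * B q d i t"
  have sym: "DS (a # b # c # d # I @ [i]) = - DS (b # a # c # d # I @ [i])"
      "DS (a # b # c # d # I @ [i]) = DS (c # d # a # b # I @ [i])" if "length I = j" for a b c d I i
    using curvature_typeD[OF C p VF_e VF_e VF_e VF_e, of "map e (I @ [i])" a b c d] that VF_map_e
    by (simp_all add: DS_def component_def VF_e)
  \<comment> \<open>Exchange the pairs, swap within the first one, exchange back.\<close>
  have sym34: "DS (a # b # c # d # I @ [i]) = - DS (a # b # d # c # I @ [i])" if "length I = j" for a b c d I i
    using sym[OF that, of a b c d i] sym(1)[OF that, of c d a b i] sym(2)[OF that, of d c a b i] by simp
  have slots: "(\<Sum>I\<in>{I. length I = 4 + j}. F I)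
      = (\<Sum>a\<in>UNIV. \<Sum>b\<in>UNIV. \<Sum>c\<in>UNIV. \<Sum>d\<in>UNIV. \<Sum>I\<in>?J. F (a # b # c # d # I))" for F :: "'n list \<Rightarrow> real"
    by (simp add: numeral_eq_Suc sum_lists_Cons)
  have F3: "(\<Sum>I\<in>?J. ?F 3 (a # b # c # d # I)) = ?P a b c d" for a b c d
    by (simp add: numeral_eq_Suc)
  have F2: "(\<Sum>I\<in>?J. ?F 2 (a # b # c # d # I)) = ?P a b d c" for a b c d
    by (intro sum.cong refl) (simp add: numeral_eq_Suc sym34[of _ a b _ d])
  have F1: "(\<Sum>I\<in>?J. ?F 1 (a # b # c # d # I)) = ?P c d a b" for a b c d
    by (intro sum.cong refl) (simp add: sym(2)[of _ a _ c d])
  have F0: "(\<Sum>I\<in>?J. ?F 0 (a # b # c # d # I)) = ?P c d b a" for a b c d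
    by (intro sum.cong refl) (simp add: sym(1)[of _ _ b c d] sym(2)[of _ b _ c d])
  have P: "?P a b c d = (\<Sum>q\<in>UNIV. \<Sum>I\<in>?J. \<Sum>i\<in>UNIV. \<Sum>t\<in>UNIV.
      DS ([a, b, c, d] @ I @ [i]) * DS ([a, b, c, q] @ I @ [t]) * B q d i t)" for a b c d
  proof -
    have "?P a b c d = (\<Sum>I\<in>?J. \<Sum>q\<in>UNIV. \<Sum>i\<in>UNIV. \<Sum>t\<in>UNIV.
      DS ([a, b, c, d] @ I @ [i]) * DS ([a, b, c, q] @ I @ [t]) * B q d i t)"
      by (rule sum.cong[OF refl], rule sum.swap)
    also have "\<dots> = (\<Sum>q\<in>UNIV. \<Sum>I\<in>?J. \<Sum>i\<in>UNIV. \<Sum>t\<in>UNIV.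
      DS ([a, b, c, d] @ I @ [i]) * DS ([a, b, c, q] @ I @ [t]) * B q d i t)"
      by (rule sum.swap)
    finally show ?thesis .
  qed
  define \<Sigma> where "\<Sigma> = (\<Sum>a\<in>UNIV. \<Sum>b\<in>UNIV. \<Sum>c\<in>UNIV. \<Sum>d\<in>UNIV. ?P a b c d)"
  have S3: "(\<Sum>I\<in>{I. length I = 4 + j}. ?F 3 I) = \<Sigma>"
    unfolding slots F3 \<Sigma>_def ..
  have S2: "(\<Sum>I\<in>{I. length I = 4 + j}. ?F 2 I) = \<Sigma>"
    unfolding slots F2 \<Sigma>_def by (rule sum_swap_last)
  have S1: "(\<Sum>I\<in>{I. length I = 4 + j}. ?F 1 I) = \<Sigma>"
    unfolding slots F1 \<Sigma>_def by (rule sum_swap_pairs)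
  have S0: "(\<Sum>I\<in>{I. length I = 4 + j}. ?F 0 I) = \<Sigma>"
    unfolding slots F0 \<Sigma>_def
    by (rule trans[OF sum_swap_pairs[of "\<lambda>a b c d. ?P a b d c"] sum_swap_last])
  have "(\<Sum>m<4 + j. \<Sum>I\<in>{I. length I = 4 + j}. ?F m I)
      = 4 * \<Sigma> + (\<Sum>m<j. \<Sum>I\<in>{I. length I = 4 + j}. ?F (4 + m) I)"
  proof -
    have "(\<Sum>m<4 + j. f m) = f 0 + f 1 + f 2 + f 3 + (\<Sum>m<j. f (4 + m))" for f :: "nat \<Rightarrow> real"
      by (simp add: numeral_eq_Suc sum.lessThan_Suc_shift add.assoc del: sum.lessThan_Suc)
    then show ?thesis by (simp only: S0 S1 S2 S3)
  qed
  also have "(\<Sum>m<j. \<Sum>I\<in>{I. length I = 4 + j}. ?F (4 + m) I)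
     = (\<Sum>m<j. \<Sum>a\<in>UNIV. \<Sum>b\<in>UNIV. \<Sum>c\<in>UNIV. \<Sum>d\<in>UNIV.
             \<Sum>I\<in>?J. \<Sum>i\<in>UNIV. \<Sum>q\<in>UNIV. \<Sum>t\<in>UNIV.
               DS ([a, b, c, d] @ I @ [i]) * DS ([a, b, c, d] @ I[m := q] @ [t]) * B q (I ! m) i t)"
    unfolding slots by (simp add: numeral_eq_Suc)
  finally show ?thesis unfolding \<Sigma>_def P .
qed

end

section \<open>Derivatives of the Weyl tensor of an Einstein four-manifold\<close>

theorem proposition5p4:
  fixes A :: "('a::{t2_space, second_countable_topology}, 4) chart set"
    and g :: "'a metric" and D :: "'a connection"
    and U :: "'a set" and e :: "4 \<Rightarrow> 'a vfield" and p :: 'a and k :: nat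
  assumes "smooth_atlas A"
    and "riemannian_metric A g"
    and "levi_civita_connection A g D"
    and "einstein A g D"
    and "orthonormal_frame_on A g U e"
    and "p \<in> U"
    and "k \<ge> 2"
  defines "W \<equiv> weyl A g D e"
    and "R \<equiv> scalar_curvature A g D e"
    and "Rm \<equiv> \<lambda>I. component e (riemann A g D) I p"
  defines "nablaW \<equiv> \<lambda>m. (cov_deriv D ^^ m) W"
  defines "DW \<equiv> \<lambda>I. component e (nablaW k) I p"
  shows "1/2 * laplacian D e (tensor_norm_sq e (4 + k) (nablaW k)) p =
      tensor_norm_sq e (4 + (k + 1)) (nablaW (k + 1)) p
    + tensor_inner e (4 + k) (nablaW k)
        (cov_deriv D (tensor_laplacian D e (nablaW (k - 1)))) p
    + R p / 4 * tensor_norm_sq e (4 + k) (nablaW k) p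
    + 8 * (\<Sum>\<alpha>\<in>UNIV. \<Sum>\<beta>\<in>UNIV. \<Sum>\<gamma>\<in>UNIV. \<Sum>i0\<in>UNIV. \<Sum>j0\<in>UNIV.
             \<Sum>I\<in>{I. length I = k - 1}. \<Sum>ik\<in>UNIV. \<Sum>jk\<in>UNIV.
               DW ([\<alpha>, \<beta>, \<gamma>, i0] @ I @ [ik]) * DW ([\<alpha>, \<beta>, \<gamma>, j0] @ I @ [jk]) * Rm [j0, i0, ik, jk])
    + 2 * (\<Sum>h=1..k - 1. \<Sum>\<alpha>\<in>UNIV. \<Sum>\<beta>\<in>UNIV. \<Sum>\<gamma>\<in>UNIV. \<Sum>\<delta>\<in>UNIV.
             \<Sum>I\<in>{I. length I = k - 1}. \<Sum>ik\<in>UNIV. \<Sum>jh\<in>UNIV. \<Sum>jk\<in>UNIV.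
               DW ([\<alpha>, \<beta>, \<gamma>, \<delta>] @ I @ [ik]) * DW ([\<alpha>, \<beta>, \<gamma>, \<delta>] @ I[h - 1 := jh] @ [jk])
                 * Rm [jh, I ! (h - 1), ik, jk])"
proof -
  have "open U" using assms(5) unfolding orthonormal_frame_on_def by (rule conjunct1)
  then interpret framed A g D U e
    by (intro framed.intro levi_civita_on.intro manifold.intro levi_civita_on_axioms.intro framed_axioms.intro assms(1-3,5))
  obtain c where c: "\<forall>U e X Y. orthonormal_frame_on A g U e \<and> vector_field_on A U X \<and> vector_field_on A U Y \<longrightarrow>
      (\<forall>p\<in>U. ricci A g D e [X, Y] p = c * metric_tensor g [X, Y] p)"
    using assms(4) unfolding einstein_def by (rule exE)
  have ricci: "ricci A g D e [X, Y] q = c * g q (X q) (Y q)" if "VF X" "VF Y" "q \<in> U" for X Y q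
    using c[rule_format, OF conjI[OF assms(5) conjI[OF that(1,2)]] that(3)] by (simp add: metric_tensor_def)
  interpret einstein_framed A g D U e c
  proof
    show "(\<Sum>t\<in>UNIV. rm q X (e t) Y (e t)) = c * g q (X q) (Y q)" if "VF X" "VF Y" "q \<in> U" for X Y q
      using ricci[OF that] by (simp add: ricci_def riemann_def numeral_eq_Suc)
  qed
  \<comment> \<open>The trace of Ric = c g over four frame fields; c = R / 4 is the coefficient in
    the formula.\<close>
  have R: "R q = 4 * c" if "q \<in> U" for q
    using that by (simp add: R_def scalar_curvature_def ricci[OF VF_e VF_e] g_e)
  \<comment> \<open>The Ricci terms contribute -c and the scalar term 4 c / 6 times the same
    quadratic expression in g; together this is -c / 3.\<close>
  have weyl: "weyl A g D e [X, Y, Z, V] q = weyl_part (c / 3) X Y Z V q"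
    if "VF X" "VF Y" "VF Z" "VF V" "q \<in> U" for X Y Z V q
    using that R[OF that(5)]
    by (simp add: weyl_def Let_def numeral_eq_Suc ricci metric_tensor_def riemann_def R_def field_simps)
  have tensor: "tensor_on 4 W"
  proof (rule tensor_on_cong[OF tensor_on_weyl_part[of "c / 3"]])
    fix Xs :: "'a vfield list" and q assume Xs: "length Xs = 4" "list_all VF Xs" and q: "q \<in> U"
    then obtain X Y Z V where "Xs = [X, Y, Z, V]" by (auto simp: numeral_eq_Suc length_Suc_conv)
    then show "weyl_part (c / 3) (Xs ! 0) (Xs ! 1) (Xs ! 2) (Xs ! 3) q = W Xs q"
      using Xs(2) q by (simp add: W_def weyl numeral_eq_Suc)
  qed
  have type: "curvature_type 0 W"
    unfolding curvature_type_def
  proof (intro allI ballI impI)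
    fix X Y Z V q and Xs :: "'a vfield list"
    assume q: "q \<in> U" and "list_all VF [X, Y, Z, V]" "length Xs = 0"
    then have F: "VF X" "VF Y" "VF Z" "VF V" "Xs = []" by auto
    show "W ([X, Y, Z, V] @ Xs) q = - W ([Y, X, Z, V] @ Xs) q \<and> W ([X, Y, Z, V] @ Xs) q = W ([Z, V, X, Y] @ Xs) q"
      using weyl_part_symmetries[OF q F(1-4), of "c / 3"] unfolding W_def F(5) append_Nil2
        weyl[OF F(1-4) q] weyl[OF F(2,1,3,4) q] weyl[OF F(3,4,1,2) q] by blast
  qed
  \<comment> \<open>The Bochner formula is applied to the derivative of order j, so that its
    \<nabla>T is the derivative of order k.\<close>
  define j where "j = k - 1"
  have k: "k = Suc j" using assms(7) by (simp add: j_def)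
  have nabla: "nablaW (Suc m) = cov_deriv D (nablaW m)" for m by (simp add: nablaW_def)
  have Tj: "tensor_on (4 + j) (nablaW j)" unfolding nablaW_def by (rule tensor_on_iterated[OF tensor])
  have Ck: "curvature_type (Suc j) (nablaW k)"
    unfolding nablaW_def k by (rule curvature_type_iterated[OF tensor type])
  have Rm: "Rm [a, b, i, t] = rm p (e a) (e b) (e i) (e t)" for a b i t
    by (simp add: Rm_def component_def riemann_def numeral_eq_Suc)
  have "(\<Sum>m<4 + j. \<Sum>I\<in>{I. length I = 4 + j}. \<Sum>i\<in>UNIV. \<Sum>q\<in>UNIV. \<Sum>t\<in>UNIV.
        DW (I @ [i]) * DW (I[m := q] @ [t]) * Rm [q, I ! m, i, t])
     = 4 * (\<Sum>\<alpha>\<in>UNIV. \<Sum>\<beta>\<in>UNIV. \<Sum>\<gamma>\<in>UNIV. \<Sum>i0\<in>UNIV. \<Sum>j0\<in>UNIV.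
             \<Sum>I\<in>{I. length I = j}. \<Sum>ik\<in>UNIV. \<Sum>jk\<in>UNIV.
               DW ([\<alpha>, \<beta>, \<gamma>, i0] @ I @ [ik]) * DW ([\<alpha>, \<beta>, \<gamma>, j0] @ I @ [jk]) * Rm [j0, i0, ik, jk])
    + (\<Sum>m<j. \<Sum>\<alpha>\<in>UNIV. \<Sum>\<beta>\<in>UNIV. \<Sum>\<gamma>\<in>UNIV. \<Sum>\<delta>\<in>UNIV.
             \<Sum>I\<in>{I. length I = j}. \<Sum>ik\<in>UNIV. \<Sum>jh\<in>UNIV. \<Sum>jk\<in>UNIV.
               DW ([\<alpha>, \<beta>, \<gamma>, \<delta>] @ I @ [ik]) * DW ([\<alpha>, \<beta>, \<gamma>, \<delta>] @ I[m := jh] @ [jk])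
                 * Rm [jh, I ! m, ik, jk])"
    unfolding DW_def by (rule curvature_action_sum[OF Ck assms(6)])
  moreover have "1/2 * laplacian D e (tensor_norm_sq e (4 + k) (nablaW k)) p =
      tensor_norm_sq e (4 + (k + 1)) (nablaW (k + 1)) p
    + tensor_inner e (4 + k) (nablaW k) (cov_deriv D (tensor_laplacian D e (nablaW j))) p
    + c * tensor_norm_sq e (4 + k) (nablaW k) p
    + 2 * (\<Sum>m<4 + j. \<Sum>I\<in>{I. length I = 4 + j}. \<Sum>i\<in>UNIV. \<Sum>q\<in>UNIV. \<Sum>t\<in>UNIV.
        DW (I @ [i]) * DW (I[m := q] @ [t]) * Rm [q, I ! m, i, t])"
    using bochner_formula[OF Tj assms(6)] unfolding DW_def Rm by (simp add: k nabla)
  moreover have "k - Suc 0 = j" and "R p / 4 = c" using R[OF assms(6)] by (simp_all add: j_def)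
  \<comment> \<open>Derivative indices are counted from 1 by h but from 0 in the lists;
    \<open>sum.atLeast1_atMost_eq\<close> performs the shift.\<close>
  ultimately show ?thesis
    unfolding One_nat_def \<open>k - Suc 0 = j\<close> \<open>R p / 4 = c\<close> sum.atLeast1_atMost_eq diff_Suc_Suc diff_zero
    by linarith
qed

end
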